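(* Let $\Phi$ be an irreducible twisted affine root system which is not of type $A_{2n}^{(2)}$, and let $\Psi$ be a maximal closed subroot system of $\Phi$. (1) If $\mathrm{Gr}(\Psi)=\mathring\Phi$, then there exist a $\mathbb Z$-linear function $p:\mathrm{Gr}(\Psi)\to\mathbb Z$ and a prime number $n_\Psi$ such that $p_\beta-\langle\beta,\alpha^\vee\rangle p_\alpha=p_{\mathbf s_\alpha(\beta)}$ for all $\alpha,\beta\in\mathrm{Gr}(\Psi)$, $p_\alpha\in m\mathbb Z$ for long roots $\alpha$, and $$\Psi=\begin{cases}\{\alpha+(p_\alpha+rn_\Psi)\delta,\ \beta+(p_\beta+mrn_\Psi)\delta:\alpha\in\mathring\Phi_s,\ \beta\in\mathring\Phi_\ell,\ r\in\mathbb Z\}&\text{if }m\neq n_\Psi,\\ \{\alpha+(p_\alpha+rn_\Psi)\delta:\alpha\in\mathring\Phi,\ r\in\mathbb Z\}&\text{if }m=n_\Psi.\end{cases}$$ Conversely, given a prime number $n_\Psi$ and a $\mathbb Z$-linear function $p:\mathring\Phi\to\mathbb Z$ satisfying $p_\alpha\in m\mathbb Z$ for all long roots $\alpha\in\mathring\Phi_\ell$ and $p_\beta-\langle\beta,\alpha^\vee\rangle p_\alpha=p_{\mathbf s_\alpha(\beta)}$ for all $\alpha,\beta\in\mathring\Phi$, the set $\Psi$ defined by the displayed formula is a maximal closed subroot system of $\Phi$. (2) If $\mathrm{Gr}(\Psi)\subsetneq\mathring\Phi$ is a proper closed subroot system, then $\mathrm{Gr}(\Psi)$ is a maximal closed subroot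 system of $\mathring\Phi$ containing at least one short root, and in this case $\Psi=\widehat{\mathrm{Gr}(\Psi)}$. Conversely, if $\mathring\Psi\subsetneq\mathring\Phi$ is a maximal closed subroot system containing a short root, then $\widehat{\mathring\Psi}$ is a maximal closed subroot system of $\Phi$.
   Context: Here $\Phi$ is the set of real roots of a twisted affine Kac–Moody algebra of type $A_{2n-1}^{(2)}$ ($n\ge3$), $D_{n+1}^{(2)}$ ($n\ge2$), $E_6^{(2)}$ or $D_4^{(3)}$; put $m=2$ in the first three cases and $m=3$ for $D_4^{(3)}$. Let $\mathring\Phi$ be the finite root system of type $C_n$, $B_n$, $F_4$, $G_2$ respectively, with short roots $\mathring\Phi_s$ and long roots $\mathring\Phi_\ell$, and let $\delta$ be a vector linearly independent of $\mathring\Phi$ with $(\delta,\cdot)=0$. Then $$\Phi=\{\alpha+r\delta:\alpha\in\mathring\Phi_s,r\in\mathbb Z\}\cup\{\alpha+mr\delta:\alpha\in\mathring\Phi_\ell,r\in\mathbb Z\}.$$ $\langle\beta,\alpha^\vee\rangle=2(\beta,\alpha)/(\alpha,\alpha)$ and $\mathbf s_\alpha(\beta)=\beta-\langle\beta,\alpha^\vee\rangle\alpha$. A non-empty subset $\Psi$ of $R$ ($R=\Phi$ or $\mathring\Phi$) is a subroot system if $\mathbf s_\alpha(\beta)\in\Psi$ for all $\alpha,\beta\in\Psi$; it is closed if $\alpha,\beta\in\Psi$, $\alpha+\beta\in R$ imply $\alpha+\beta\in\Psi$. A maximal closed subroot system of $R$ is a proper closed subroot system $\Psi$ such that $\Psi\subseteq\Delta\subsetneq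 R$ with $\Delta$ a closed subroot system implies $\Delta=\Psi$. The gradient is $\mathrm{Gr}(\Psi)=\{\alpha\in\mathring\Phi:\alpha+r\delta\in\Psi\text{ for some }r\}$. The lift of a subroot system $\mathring\Psi\subseteq\mathring\Phi$ is $\widehat{\mathring\Psi}=\{\alpha+r\delta\in\Phi:\alpha\in\mathring\Psi\}$. A function on a finite root system is $\mathbb Z$-linear if it is the restriction of an additive homomorphism from the lattice it spans. *)

theory Defs
  imports "HOL-Analysis.Analysis" "HOL-Computational_Algebra.Group_Closure"
begin

section \<open>Roots with respect to a symmetric bilinear form\<close>

text \<open>
  Throughout, \<open>B\<close> is a symmetric bilinear form on a real vector space. It is allowed to be
  degenerate, since the null root \<open>\<delta>\<close> lies in its radical.
\<close>

definition cartan_pairing :: "('v::real_vector \<Rightarrow> 'v \<Rightarrow> real) \<Rightarrow> 'v \<Rightarrow> 'v \<Rightarrow> real" where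
  "cartan_pairing B \<beta> \<alpha> = 2 * B \<beta> \<alpha> / B \<alpha> \<alpha>"

definition root_reflection :: "('v::real_vector \<Rightarrow> 'v \<Rightarrow> real) \<Rightarrow> 'v \<Rightarrow> 'v \<Rightarrow> 'v" where
  "root_reflection B \<alpha> \<beta> = \<beta> - cartan_pairing B \<beta> \<alpha> *\<^sub>R \<alpha>"

definition subroot_system ::
    "('v::real_vector \<Rightarrow> 'v \<Rightarrow> real) \<Rightarrow> 'v set \<Rightarrow> 'v set \<Rightarrow> bool" where
  "subroot_system B R \<Psi> \<longleftrightarrow>
     \<Psi> \<noteq> {} \<and> \<Psi> \<subseteq> R \<and> (\<forall>\<alpha>\<in>\<Psi>. \<forall>\<beta>\<in>\<Psi>. root_reflection B \<alpha> \<beta> \<in> \<Psi>)"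

definition closed_subroot_system ::
    "('v::real_vector \<Rightarrow> 'v \<Rightarrow> real) \<Rightarrow> 'v set \<Rightarrow> 'v set \<Rightarrow> bool" where
  "closed_subroot_system B R \<Psi> \<longleftrightarrow>
     subroot_system B R \<Psi> \<and> (\<forall>\<alpha>\<in>\<Psi>. \<forall>\<beta>\<in>\<Psi>. \<alpha> + \<beta> \<in> R \<longrightarrow> \<alpha> + \<beta> \<in> \<Psi>)"

definition maximal_closed_subroot_system ::
    "('v::real_vector \<Rightarrow> 'v \<Rightarrow> real) \<Rightarrow> 'v set \<Rightarrow> 'v set \<Rightarrow> bool" where
  "maximal_closed_subroot_system B R \<Psi> \<longleftrightarrow>
     closed_subroot_system B R \<Psi> \<and> \<Psi> \<subset> R \<and>
     (\<forall>\<Delta>. closed_subroot_system B R \<Delta> \<and> \<Psi> \<subseteq> \<Delta> \<and> \<Delta> \<subset> R \<longrightarrow> \<Delta> = \<Psi>)"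


section \<open>Finite root systems of types \<open>B\<^sub>n\<close>, \<open>C\<^sub>n\<close>, \<open>F\<^sub>4\<close>, \<open>G\<^sub>2\<close>\<close>

text \<open>
  Reduced crystallographic root systems. The ambient space may be larger than the span of the
  roots, so positive definiteness is only demanded on that span.
\<close>

definition finite_root_system :: "('v::real_vector \<Rightarrow> 'v \<Rightarrow> real) \<Rightarrow> 'v set \<Rightarrow> bool" where
  "finite_root_system B R \<longleftrightarrow>
     finite R \<and> R \<noteq> {} \<and> 0 \<notin> R \<and>
     (\<forall>x\<in>span R. x \<noteq> 0 \<longrightarrow> B x x > 0) \<and>
     (\<forall>\<alpha>\<in>R. \<forall>\<beta>\<in>R. root_reflection B \<alpha> \<beta> \<in> R) \<and>
     (\<forall>\<alpha>\<in>R. \<forall>\<beta>\<in>R. cartan_pairing B \<beta> \<alpha> \<in> \<int>) \<and>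
     (\<forall>\<alpha>\<in>R. \<forall>c. c *\<^sub>R \<alpha> \<in> R \<longrightarrow> c = 1 \<or> c = -1)"

definition simple_roots :: "'v::real_vector set \<Rightarrow> nat \<Rightarrow> (nat \<Rightarrow> 'v) \<Rightarrow> bool" where
  "simple_roots R n a \<longleftrightarrow>
     inj_on a {1..n} \<and> independent (a ` {1..n}) \<and> a ` {1..n} \<subseteq> R \<and>
     (\<forall>\<beta>\<in>R. \<exists>c::nat \<Rightarrow> nat.
        \<beta> = (\<Sum>i=1..n. real (c i) *\<^sub>R a i) \<or> \<beta> = - (\<Sum>i=1..n. real (c i) *\<^sub>R a i))"

datatype finite_type = TypeB nat | TypeC nat | TypeF4 | TypeG2

fun type_rank :: "finite_type \<Rightarrow> nat" where
  "type_rank (TypeB n) = n"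
| "type_rank (TypeC n) = n"
| "type_rank TypeF4 = 4"
| "type_rank TypeG2 = 2"

text \<open>
  The \<open>(i, j)\<close> entry of the Cartan matrix is \<open>\<langle>\<alpha>\<^sub>i, \<alpha>\<^sub>j\<^sup>\<or>\<rangle>\<close>, with the simple roots numbered as in
  Bourbaki: \<open>\<alpha>\<^sub>n\<close> is the short simple root of \<open>B\<^sub>n\<close> and the long one of \<open>C\<^sub>n\<close>; \<open>\<alpha>\<^sub>3, \<alpha>\<^sub>4\<close> are short
  in \<open>F\<^sub>4\<close>; \<open>\<alpha>\<^sub>1\<close> is short in \<open>G\<^sub>2\<close>.
\<close>

definition linear_cartan :: "nat \<Rightarrow> nat \<Rightarrow> int" where
  "linear_cartan i j = (if i = j then 2 else if j = Suc i \<or> i = Suc j then -1 else 0)"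

fun cartan_matrix :: "finite_type \<Rightarrow> nat \<Rightarrow> nat \<Rightarrow> int" where
  "cartan_matrix (TypeB n) i j = (if Suc i = n \<and> j = n then -2 else linear_cartan i j)"
| "cartan_matrix (TypeC n) i j = (if i = n \<and> Suc j = n then -2 else linear_cartan i j)"
| "cartan_matrix TypeF4 i j = (if i = 2 \<and> j = 3 then -2 else linear_cartan i j)"
| "cartan_matrix TypeG2 i j = (if i = 2 \<and> j = 1 then -3 else linear_cartan i j)"

definition root_system_of_type ::
    "finite_type \<Rightarrow> ('v::real_vector \<Rightarrow> 'v \<Rightarrow> real) \<Rightarrow> 'v set \<Rightarrow> bool" where
  "root_system_of_type T B R \<longleftrightarrow>
     finite_root_system B R \<and>
     (\<exists>a. simple_roots R (type_rank T) a \<and>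
        (\<forall>i\<in>{1..type_rank T}. \<forall>j\<in>{1..type_rank T}.
           cartan_pairing B (a i) (a j) = of_int (cartan_matrix T i j)))"

definition short_roots :: "('v::real_vector \<Rightarrow> 'v \<Rightarrow> real) \<Rightarrow> 'v set \<Rightarrow> 'v set" where
  "short_roots B R = {\<alpha>\<in>R. \<forall>\<beta>\<in>R. B \<alpha> \<alpha> \<le> B \<beta> \<beta>}"

definition long_roots :: "('v::real_vector \<Rightarrow> 'v \<Rightarrow> real) \<Rightarrow> 'v set \<Rightarrow> 'v set" where
  "long_roots B R = {\<alpha>\<in>R. \<forall>\<beta>\<in>R. B \<beta> \<beta> \<le> B \<alpha> \<alpha>}"

definition Z_linear_on :: "'v::real_vector set \<Rightarrow> ('v \<Rightarrow> int) \<Rightarrow> bool" where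
  "Z_linear_on S p \<longleftrightarrow>
     (\<exists>f::'v \<Rightarrow> int.
        (\<forall>x\<in>group_closure S. \<forall>y\<in>group_closure S. f (x + y) = f x + f y) \<and>
        (\<forall>\<alpha>\<in>S. p \<alpha> = f \<alpha>))"


section \<open>Twisted affine root systems not of type \<open>A\<^sub>2\<^sub>n\<^sup>(\<^sup>2\<^sup>)\<close>\<close>

text \<open>
  The constructors stand for \<open>A\<^sub>2\<^sub>n\<^sub>-\<^sub>1\<^sup>(\<^sup>2\<^sup>)\<close>, \<open>D\<^sub>n\<^sub>+\<^sub>1\<^sup>(\<^sup>2\<^sup>)\<close>, \<open>E\<^sub>6\<^sup>(\<^sup>2\<^sup>)\<close> and \<open>D\<^sub>4\<^sup>(\<^sup>3\<^sup>)\<close>; the argument is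
  \<open>n\<close>, the rank of the underlying finite root system.
\<close>

datatype twisted_type = TwistedA_odd nat | TwistedD nat | TwistedE6 | TwistedD4

fun admissible_type :: "twisted_type \<Rightarrow> bool" where
  "admissible_type (TwistedA_odd n) \<longleftrightarrow> n \<ge> 3"
| "admissible_type (TwistedD n) \<longleftrightarrow> n \<ge> 2"
| "admissible_type TwistedE6 \<longleftrightarrow> True"
| "admissible_type TwistedD4 \<longleftrightarrow> True"

fun underlying_type :: "twisted_type \<Rightarrow> finite_type" where
  "underlying_type (TwistedA_odd n) = TypeC n"
| "underlying_type (TwistedD n) = TypeB n"
| "underlying_type TwistedE6 = TypeF4"
| "underlying_type TwistedD4 = TypeG2"

fun twist_order :: "twisted_type \<Rightarrow> nat" where
  "twist_order (TwistedA_odd n) = 2"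
| "twist_order (TwistedD n) = 2"
| "twist_order TwistedE6 = 2"
| "twist_order TwistedD4 = 3"

definition twisted_affine_datum ::
    "twisted_type \<Rightarrow> ('v::real_vector \<Rightarrow> 'v \<Rightarrow> real) \<Rightarrow> 'v set \<Rightarrow> 'v \<Rightarrow> bool" where
  "twisted_affine_datum X B R0 \<delta> \<longleftrightarrow>
     admissible_type X \<and>
     bilinear B \<and> (\<forall>x y. B x y = B y x) \<and>
     root_system_of_type (underlying_type X) B R0 \<and>
     \<delta> \<notin> span R0 \<and> (\<forall>x. B \<delta> x = 0)"

definition shift :: "'v::real_vector \<Rightarrow> int \<Rightarrow> 'v \<Rightarrow> 'v" where
  "shift \<delta> r \<alpha> = \<alpha> + of_int r *\<^sub>R \<delta>"

definition affine_roots ::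
    "twisted_type \<Rightarrow> ('v::real_vector \<Rightarrow> 'v \<Rightarrow> real) \<Rightarrow> 'v set \<Rightarrow> 'v \<Rightarrow> 'v set" where
  "affine_roots X B R0 \<delta> =
     {shift \<delta> r \<alpha> | \<alpha> r. \<alpha> \<in> short_roots B R0} \<union>
     {shift \<delta> (int (twist_order X) * r) \<alpha> | \<alpha> r. \<alpha> \<in> long_roots B R0}"

definition gradient :: "'v::real_vector set \<Rightarrow> 'v \<Rightarrow> 'v set \<Rightarrow> 'v set" where
  "gradient R0 \<delta> \<Psi> = {\<alpha>\<in>R0. \<exists>r. shift \<delta> r \<alpha> \<in> \<Psi>}"

definition affine_lift ::
    "twisted_type \<Rightarrow> ('v::real_vector \<Rightarrow> 'v \<Rightarrow> real) \<Rightarrow> 'v set \<Rightarrow> 'v \<Rightarrow> 'v set \<Rightarrow> 'v set" where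
  "affine_lift X B R0 \<delta> S = {shift \<delta> r \<alpha> | \<alpha> r. \<alpha> \<in> S \<and> shift \<delta> r \<alpha> \<in> affine_roots X B R0 \<delta>}"

definition translate_conditions ::
    "twisted_type \<Rightarrow> ('v::real_vector \<Rightarrow> 'v \<Rightarrow> real) \<Rightarrow> 'v set \<Rightarrow> ('v \<Rightarrow> int) \<Rightarrow> bool" where
  "translate_conditions X B R0 p \<longleftrightarrow>
     Z_linear_on R0 p \<and>
     (\<forall>\<alpha>\<in>R0. \<forall>\<beta>\<in>R0.
        of_int (p \<beta>) - cartan_pairing B \<beta> \<alpha> * of_int (p \<alpha>) = of_int (p (root_reflection B \<alpha> \<beta>))) \<and>
     (\<forall>\<alpha>\<in>long_roots B R0. int (twist_order X) dvd p \<alpha>)"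

definition full_gradient_subsystem ::
    "twisted_type \<Rightarrow> ('v::real_vector \<Rightarrow> 'v \<Rightarrow> real) \<Rightarrow> 'v set \<Rightarrow> 'v \<Rightarrow> nat \<Rightarrow> ('v \<Rightarrow> int) \<Rightarrow> 'v set" where
  "full_gradient_subsystem X B R0 \<delta> q p =
     (if twist_order X \<noteq> q then
        {shift \<delta> (p \<alpha> + r * int q) \<alpha> | \<alpha> r. \<alpha> \<in> short_roots B R0} \<union>
        {shift \<delta> (p \<beta> + int (twist_order X) * r * int q) \<beta> | \<beta> r. \<beta> \<in> long_roots B R0}
      else {shift \<delta> (p \<alpha> + r * int q) \<alpha> | \<alpha> r. \<alpha> \<in> R0})"

end

theory Submission
  imports Defs
begin

text \<open>
  The four types enter only through two facts: \<open>R0\<close> is irreducible, and it contains two roots whose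
  squared lengths have the ratio \<open>m\<close>, which is \<open>2\<close> or \<open>3\<close>. These imply that \<open>R0\<close> consists of short and
  long roots with exactly this ratio, that the Weyl group is transitive on each length, and that the
  pairing of a long root with a short coroot is \<open>m\<close> times the pairing of the short root with the long
  coroot.

  A subsystem \<open>\<Delta>\<close> of \<open>\<Phi>\<close> is studied through the sets of levels \<open>r\<close> with \<open>\<alpha> + r \<delta> \<in> \<Delta>\<close>, one for each
  \<open>\<alpha> \<in> R0\<close>. Everything rests on \<open>eq_affine_if_short_levels_UNIV\<close>: a closed subsystem with
  full gradient in which one short root has all levels is all of \<open>\<Phi>\<close>.

  Full gradient. Levels of the simple roots, extended linearly, give a function \<open>p\<close> with values in all
  the sets of levels (\<open>translate_exists\<close>). Relative to \<open>p\<close> the levels of a short root form a set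
  \<open>d \<int>\<close>, the same for all short roots, and the relative levels of long roots lie in it too. If
  \<open>\<Delta> \<noteq> \<Phi>\<close>, then \<open>d\<close> has a prime divisor \<open>q\<close>, and \<open>\<Delta>\<close> lies in the system of all \<open>\<alpha> + r \<delta> \<in> \<Phi>\<close>
  with \<open>q\<close> dividing \<open>r - p \<alpha>\<close> (\<open>subset_full_if_translate_in_levels\<close>). This is the displayed system in
  both of its cases, since \<open>p\<close> and all levels are divisible by \<open>m\<close> on long roots
  (\<open>full_gradient_subsystem_eq\<close>). The same inclusion, applied to a system that contains one of
  these, shows that they are maximal.

  Proper gradient. If the gradient is closed, then \<open>\<Psi>\<close> is its lift by maximality, and the lift of a
  set of long roots is never maximal, as it lies in the system above with \<open>p = 0\<close> and \<open>q = m\<close>. For the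
  converse the difficulty is that the gradient of a closed system \<open>\<Delta>\<close> above the lift of \<open>S\<close> need not be
  closed a priori: two short roots may add up to a long root while no sum of their levels is divisible
  by \<open>m\<close>. Such short roots would be orthogonal to all short roots of \<open>S\<close>, and
  \<open>gradient_closed_if_lift_subset\<close> derives a contradiction with the maximality of \<open>S\<close>.
\<close>

section \<open>Sets of integers stable under point reflections\<close>

text \<open>Point reflections \<open>s \<mapsto> 2 r - s\<close> compose to translations by \<open>2 (r - r')\<close>, so \<open>A\<close> contains
  with \<open>s\<close> its residue modulo \<open>2 d\<close>, where \<open>d\<close> is the least positive element. Up to sign
  this residue is at most \<open>d\<close>, hence \<open>0\<close> or \<open>d\<close>.\<close>

lemma reflection_closed_int_set:
  fixes A :: "int set"
  assumes zero: "0 \<in> A" and refl: "\<And>r s. r \<in> A \<Longrightarrow> s \<in> A \<Longrightarrow> 2 * r - s \<in> A"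
  obtains d where "A = {s. d dvd s}"
proof (cases "A = {0}")
  case True
  then show ?thesis using that[of 0] by auto
next
  case False
  have neg: "- s \<in> A" if "s \<in> A" for s using refl[OF zero that] by simp
  obtain e where "e \<in> A" "e \<noteq> 0" using False zero by auto
  then have ex: "\<exists>k::nat. k > 0 \<and> int k \<in> A"
    using neg by (intro exI[of _ "nat \<bar>e\<bar>"]) (auto simp: abs_if)
  define k where "k = (LEAST k::nat. k > 0 \<and> int k \<in> A)"
  define d where "d = int k"
  have d: "d > 0" "d \<in> A" using LeastI_ex[OF ex] by (auto simp: k_def d_def)
  have min: "d \<le> s" if "s \<in> A" "s > 0" for s
  proof -
    have "nat s > 0 \<and> int (nat s) \<in> A" using that by simp
    then have "k \<le> nat s" unfolding k_def by (rule Least_le)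
    then show ?thesis using that by (simp add: d_def)
  qed
  have trans: "s + 2 * d * int n \<in> A" if "s \<in> A" for s n
  proof (induction n)
    case (Suc n)
    then show ?case using refl[OF d(2) neg[OF Suc]] by (simp add: algebra_simps)
  qed (use that in simp)
  have trans: "s + 2 * d * j \<in> A" if "s \<in> A" for s j
  proof (cases "j \<ge> 0")
    case True
    then show ?thesis using trans[OF that, of "nat j"] by simp
  next
    case False
    then show ?thesis using neg[OF trans[OF neg[OF that], of "nat (- j)"]] by (simp add: add.commute)
  qed
  have "d dvd s" if s: "s \<in> A" for s
  proof -
    define t where "t = s mod (2 * d)"
    have "s - 2 * d * (s div (2 * d)) = t"
      by (simp add: t_def minus_mult_div_eq_mod)
    then have t: "t \<in> A" using trans[OF s, of "- (s div (2 * d))"] by simp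
    have t2: "2 * d - t \<in> A" using refl[OF d(2) t] .
    have "0 \<le> t" "t < 2 * d" using d(1) by (auto simp: t_def)
    then have "t = 0 \<or> t = d" using min[OF t] min[OF t2] by linarith
    then have "d dvd t" by auto
    then show "d dvd s" unfolding t_def by (simp add: dvd_mod_iff)
  qed
  moreover have "s \<in> A" if "d dvd s" for s
  proof -
    obtain j where j: "s = d * j" using \<open>d dvd s\<close> by (elim dvdE)
    show ?thesis
    proof (cases "even j")
      case True
      then show ?thesis using trans[OF zero, of "j div 2"] j by (auto elim!: evenE simp: algebra_simps)
    next
      case False
      then show ?thesis using trans[OF d(2), of "j div 2"] j by (auto elim!: oddE simp: algebra_simps)
    qed
  qed
  ultimately show ?thesis using that[of d] by blast
qed

section \<open>Pairings and lengths in an irreducible root system\<close>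

locale crystallographic_roots =
  fixes B :: "'v::real_vector \<Rightarrow> 'v \<Rightarrow> real" and R0 :: "'v set"
  assumes bil: "bilinear B"
    and sym: "B x y = B y x"
    and roots: "finite_root_system B R0"
begin

lemmas B_simps = bilinear_ladd[OF bil] bilinear_radd[OF bil] bilinear_lsub[OF bil]
  bilinear_rsub[OF bil] bilinear_lmul[OF bil] bilinear_rmul[OF bil] bilinear_lneg[OF bil]
  bilinear_rneg[OF bil] bilinear_lzero[OF bil] bilinear_rzero[OF bil]

text \<open>Pairings of roots are integers, so the floor only changes the type.\<close>

definition cartan_int :: "'v \<Rightarrow> 'v \<Rightarrow> int" where
  "cartan_int \<beta> \<alpha> = \<lfloor>cartan_pairing B \<beta> \<alpha>\<rfloor>"

text \<open>The non-empty unions of orbits of the Weyl group.\<close>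

definition reflection_stable :: "'v set \<Rightarrow> bool" where
  "reflection_stable T \<longleftrightarrow> T \<noteq> {} \<and> T \<subseteq> R0 \<and> (\<forall>x\<in>T. \<forall>y\<in>R0. root_reflection B y x \<in> T)"

lemma B_pos: "x \<in> R0 \<Longrightarrow> B x x > 0"
  using roots unfolding finite_root_system_def by (metis span_base)

lemma of_int_cartan_int:
  "\<alpha> \<in> R0 \<Longrightarrow> \<beta> \<in> R0 \<Longrightarrow> of_int (cartan_int \<beta> \<alpha>) = cartan_pairing B \<beta> \<alpha>"
  using roots unfolding finite_root_system_def cartan_int_def by simp

lemma two_B:
  assumes "\<alpha> \<in> R0" "\<beta> \<in> R0"
  shows "2 * B \<beta> \<alpha> = of_int (cartan_int \<beta> \<alpha>) * B \<alpha> \<alpha>"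
  using of_int_cartan_int[OF assms] B_pos[OF assms(1)] by (simp add: cartan_pairing_def)

lemma cartan_int_eqI:
  assumes "\<alpha> \<in> R0" "\<beta> \<in> R0" "2 * B \<beta> \<alpha> = of_int k * B \<alpha> \<alpha>"
  shows "cartan_int \<beta> \<alpha> = k"
  using two_B[OF assms(1,2)] B_pos[OF assms(1)] assms(3) by simp

lemma cartan_int_self: "\<alpha> \<in> R0 \<Longrightarrow> cartan_int \<alpha> \<alpha> = 2"
  by (rule cartan_int_eqI) auto

lemma cartan_int_eq_0_iff: "\<alpha> \<in> R0 \<Longrightarrow> \<beta> \<in> R0 \<Longrightarrow> cartan_int \<beta> \<alpha> = 0 \<longleftrightarrow> B \<beta> \<alpha> = 0"
  using two_B[of \<alpha> \<beta>] B_pos[of \<alpha>] by auto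

lemma root_reflection_eq:
  "\<alpha> \<in> R0 \<Longrightarrow> \<beta> \<in> R0 \<Longrightarrow> root_reflection B \<alpha> \<beta> = \<beta> - of_int (cartan_int \<beta> \<alpha>) *\<^sub>R \<alpha>"
  by (simp add: root_reflection_def of_int_cartan_int)

lemma reflection_in_roots: "\<alpha> \<in> R0 \<Longrightarrow> \<beta> \<in> R0 \<Longrightarrow> root_reflection B \<alpha> \<beta> \<in> R0"
  using roots unfolding finite_root_system_def by blast

lemma reflection_self: "\<alpha> \<in> R0 \<Longrightarrow> root_reflection B \<alpha> \<alpha> = - \<alpha>"
  by (simp add: root_reflection_eq cartan_int_self scaleR_2)

lemma minus_in_roots: "\<alpha> \<in> R0 \<Longrightarrow> - \<alpha> \<in> R0"
  using reflection_in_roots[of \<alpha> \<alpha>] by (simp add: reflection_self)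

lemma B_reflection:
  assumes "\<alpha> \<in> R0" "\<beta> \<in> R0"
  shows "B (root_reflection B \<alpha> \<beta>) (root_reflection B \<alpha> \<beta>) = B \<beta> \<beta>"
  using two_B[OF assms] sym[of \<alpha> \<beta>]
  by (simp add: root_reflection_eq[OF assms] B_simps algebra_simps)

lemma cartan_int_reflection_self:
  assumes "\<alpha> \<in> R0" "\<beta> \<in> R0"
  shows "cartan_int (root_reflection B \<alpha> \<beta>) \<alpha> = - cartan_int \<beta> \<alpha>"
  using two_B[OF assms]
  by (intro cartan_int_eqI[OF assms(1) reflection_in_roots[OF assms]])
    (simp add: root_reflection_eq[OF assms] B_simps algebra_simps)

lemma reflection_involution:
  assumes "\<alpha> \<in> R0" "\<beta> \<in> R0"
  shows "root_reflection B \<alpha> (root_reflection B \<alpha> \<beta>) = \<beta>"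
  using root_reflection_eq[OF assms(1) reflection_in_roots[OF assms]]
    root_reflection_eq[OF assms] cartan_int_reflection_self[OF assms] by simp

lemma cartan_int_add:
  assumes "\<alpha> \<in> R0" "\<beta> \<in> R0" "\<gamma> \<in> R0" "\<beta> + \<gamma> \<in> R0"
  shows "cartan_int (\<beta> + \<gamma>) \<alpha> = cartan_int \<beta> \<alpha> + cartan_int \<gamma> \<alpha>"
  using two_B[OF assms(1,2)] two_B[OF assms(1,3)] assms
  by (intro cartan_int_eqI) (auto simp: B_simps algebra_simps)

lemma cartan_int_reflection:
  assumes "\<alpha> \<in> R0" "\<beta> \<in> R0" "\<gamma> \<in> R0"
  shows "cartan_int (root_reflection B \<gamma> \<beta>) \<alpha> = cartan_int \<beta> \<alpha> - cartan_int \<beta> \<gamma> * cartan_int \<gamma> \<alpha>"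
  using two_B[OF assms(1,2)] two_B[OF assms(1,3)] assms
  by (intro cartan_int_eqI reflection_in_roots) (auto simp: root_reflection_eq B_simps algebra_simps)

text \<open>The form need not be positive definite, but it is so on the span of the roots.\<close>

lemma strict_Cauchy_Schwarz:
  assumes x: "x \<in> R0" and y: "y \<in> R0" and ne: "x \<noteq> y" "x \<noteq> - y"
  shows "(B x y)\<^sup>2 < B x x * B y y"
proof -
  define z where "z = B y y *\<^sub>R x - B x y *\<^sub>R y"
  have yy: "B y y > 0" using B_pos[OF y] .
  have zspan: "z \<in> span R0" unfolding z_def
    by (intro span_diff span_mul span_base x y)
  have "z \<noteq> 0"
  proof
    assume "z = 0"
    then have "B y y *\<^sub>R x = B x y *\<^sub>R y" by (simp add: z_def)
    then have "x = (B x y / B y y) *\<^sub>R y"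
      using yy by (metis divide_inverse_commute less_irrefl scaleR_one scaleR_scaleR left_inverse)
    then show False using ne x y roots unfolding finite_root_system_def
      by (metis scaleR_minus1_left scaleR_one)
  qed
  then have "B z z > 0" using zspan roots unfolding finite_root_system_def by blast
  moreover have "B z z = B y y * (B x x * B y y - (B x y)\<^sup>2)"
    using sym[of x y] by (simp add: z_def B_simps power2_eq_square algebra_simps)
  ultimately show ?thesis using yy by (simp add: zero_less_mult_iff)
qed

lemma cartan_int_product:
  assumes x: "x \<in> R0" and y: "y \<in> R0"
  shows "of_int (cartan_int x y * cartan_int y x) * (B x x * B y y) = (2 * B x y)\<^sup>2"
proof -
  have "of_int (cartan_int x y * cartan_int y x) * (B x x * B y y)
      = (of_int (cartan_int x y) * B y y) * (of_int (cartan_int y x) * B x x)" by simp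
  also have "\<dots> = (2 * B x y) * (2 * B y x)" using two_B[OF x y] two_B[OF y x] by simp
  finally show ?thesis using sym[of x y] by (simp add: power2_eq_square)
qed

lemma cartan_int_product_less_4:
  assumes x: "x \<in> R0" and y: "y \<in> R0" and ne: "x \<noteq> y" "x \<noteq> - y"
  shows "cartan_int x y * cartan_int y x < 4"
proof -
  have "of_int (cartan_int x y * cartan_int y x) * (B x x * B y y) = 4 * (B x y)\<^sup>2"
    using cartan_int_product[OF x y] by (simp add: power_mult_distrib)
  also have "\<dots> < 4 * (B x x * B y y)" using strict_Cauchy_Schwarz[OF assms] by simp
  finally have "of_int (cartan_int x y * cartan_int y x) < (4::real)"
    using B_pos[OF x] B_pos[OF y] by (meson mult_less_cancel_right_pos mult_pos_pos)
  then show ?thesis by linarith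
qed

lemma cartan_int_equal_length:
  assumes x: "x \<in> R0" and y: "y \<in> R0" and "B x x = B y y" and ne: "x \<noteq> y" "x \<noteq> - y"
    and nz: "B x y \<noteq> 0"
  shows "cartan_int x y = 1 \<or> cartan_int x y = - 1"
proof -
  have "cartan_int y x = cartan_int x y"
    using two_B[OF y x] assms(3) sym[of x y] by (intro cartan_int_eqI x y) auto
  then have "(cartan_int x y)\<^sup>2 < 2\<^sup>2"
    using cartan_int_product_less_4[OF x y ne] by (simp add: power2_eq_square)
  then have "\<bar>cartan_int x y\<bar> < 2"
    using power2_less_imp_less[of "\<bar>cartan_int x y\<bar>" 2] by simp
  moreover have "cartan_int x y \<noteq> 0" using nz cartan_int_eq_0_iff[OF y x] by simp
  ultimately show ?thesis by arith
qed

text \<open>The squared lengths have the ratio of the two pairings, which have the same sign and a product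
  of at most \<open>3\<close>.\<close>

lemma length_ratio:
  assumes x: "x \<in> R0" and y: "y \<in> R0" and nz: "B x y \<noteq> 0"
  shows "B x x = B y y \<or> B x x = 2 * B y y \<or> B x x = 3 * B y y \<or> B y y = 2 * B x x \<or> B y y = 3 * B x x"
proof (cases "x = y \<or> x = - y")
  case True
  then show ?thesis by (auto simp: B_simps)
next
  case False
  define k l where "k = \<bar>cartan_int x y\<bar>" and "l = \<bar>cartan_int y x\<bar>"
  have kB: "2 * \<bar>B x y\<bar> = of_int k * B y y" "2 * \<bar>B x y\<bar> = of_int l * B x x"
    using arg_cong[OF two_B[OF y x], of abs] arg_cong[OF two_B[OF x y], of abs]
      B_pos[OF x] B_pos[OF y] sym[of x y]
    by (simp_all add: k_def l_def abs_mult)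
  have "k > 0" "l > 0"
    using nz cartan_int_eq_0_iff[OF y x] cartan_int_eq_0_iff[OF x y] sym[of x y]
    by (auto simp: k_def l_def)
  moreover have "k * l < 4"
  proof -
    have "of_int (cartan_int x y * cartan_int y x) * (B x x * B y y) \<ge> 0"
      unfolding cartan_int_product[OF x y] by simp
    moreover have "B x x * B y y > 0" using B_pos[OF x] B_pos[OF y] by simp
    ultimately have "(0::real) \<le> of_int (cartan_int x y * cartan_int y x)"
      by (metis zero_le_mult_iff less_le_not_le)
    then have "cartan_int x y * cartan_int y x \<ge> 0" by (simp only: of_int_0_le_iff)
    then show ?thesis using cartan_int_product_less_4[OF x y] False
      by (simp add: k_def l_def flip: abs_mult)
  qed
  moreover have "k \<le> k * l" "l \<le> k * l" using \<open>k > 0\<close> \<open>l > 0\<close> by auto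
  ultimately have "k = 1 \<or> k = 2 \<or> k = 3" "l = 1 \<or> l = 2 \<or> l = 3" "k * l < 4" by linarith+
  then have "(k, l) \<in> {(1,1),(1,2),(2,1),(1,3),(3,1)}" by auto
  then show ?thesis using kB by auto
qed

end

locale irreducible_roots = crystallographic_roots +
  assumes irreducible: "\<And>T. T \<subseteq> R0 \<Longrightarrow> T \<noteq> {} \<Longrightarrow> (\<And>x y. x \<in> T \<Longrightarrow> y \<in> R0 - T \<Longrightarrow> B x y = 0) \<Longrightarrow> T = R0"
begin

text \<open>The roots that are orthogonal to all of \<open>T\<close> are orthogonal to all others: if \<open>y\<close> is not
  orthogonal to \<open>t \<in> T\<close>, then \<open>y\<close> is a combination of \<open>t\<close> and its reflection in \<open>y\<close>, which is again in \<open>T\<close>.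
  So irreducibility leaves no such roots.\<close>

lemma reflection_stable_not_orthogonal:
  assumes T: "reflection_stable T" and y: "y \<in> R0"
  obtains t where "t \<in> T" "B t y \<noteq> 0"
proof -
  define U where "U = {y \<in> R0. \<exists>t\<in>T. B t y \<noteq> 0}"
  have TR: "T \<subseteq> R0" and Tne: "T \<noteq> {}"
    and Tr: "\<And>x z. x \<in> T \<Longrightarrow> z \<in> R0 \<Longrightarrow> root_reflection B z x \<in> T"
    using T unfolding reflection_stable_def by auto
  have "U = R0"
  proof (rule irreducible)
    show "U \<subseteq> R0" by (auto simp: U_def)
    obtain t where "t \<in> T" using Tne by auto
    then have "t \<in> U" unfolding U_def using TR B_pos[of t] by force
    then show "U \<noteq> {}" by auto
  next
    fix u z assume u: "u \<in> U" and z: "z \<in> R0 - U"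
    then obtain t where t: "t \<in> T" "B t u \<noteq> 0" "u \<in> R0" by (auto simp: U_def)
    have z0: "\<And>s. s \<in> T \<Longrightarrow> B s z = 0" using z by (auto simp: U_def)
    have "B (root_reflection B u t) z = 0" using z0 Tr t by blast
    then have "cartan_pairing B t u * B u z = 0"
      using z0[OF t(1)] by (simp add: root_reflection_def B_simps)
    then show "B u z = 0" using t B_pos[OF t(3)] by (simp add: cartan_pairing_def)
  qed
  then show ?thesis using y that unfolding U_def by blast
qed

text \<open>The Weyl group is transitive on the roots of one length: an orbit of roots as long as \<open>y\<close> has
  a member \<open>z\<close> that is not orthogonal to \<open>y\<close>, and \<open>y\<close> and \<open>z\<close> lie in a system of type \<open>A\<^sub>1\<close> or
  \<open>A\<^sub>2\<close>.\<close>

lemma reflection_stable_equal_length: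
  assumes T: "reflection_stable T" and x: "x \<in> T" and y: "y \<in> R0" and len: "B x x = B y y"
  shows "y \<in> T"
proof -
  have TR: "T \<subseteq> R0" and Tr: "\<And>x z. x \<in> T \<Longrightarrow> z \<in> R0 \<Longrightarrow> root_reflection B z x \<in> T"
    using T unfolding reflection_stable_def by auto
  have "reflection_stable {t \<in> T. B t t = B x x}"
    using x TR Tr B_reflection unfolding reflection_stable_def by auto
  then obtain z where z: "z \<in> T" "B z z = B y y" "B z y \<noteq> 0"
    using reflection_stable_not_orthogonal[OF _ y] len by force
  have zR: "z \<in> R0" using z TR by auto
  have neg: "- t \<in> T" if "t \<in> T" for t
    using Tr[OF that, of t] that TR reflection_self by auto
  show ?thesis
  proof (cases "z = y \<or> z = - y")
    case True
    then show ?thesis using z neg[of z] by auto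
  next
    case False
    (* In type A2, reflecting z in y and the result in z gives y up to sign. *)
    have c: "cartan_int z y = 1 \<or> cartan_int z y = - 1"
      using cartan_int_equal_length[OF zR y z(2)] False z(3) by auto
    have d: "cartan_int y z = cartan_int z y"
      using two_B[OF y zR] z(2) sym[of y z] by (intro cartan_int_eqI zR y) auto
    define w where "w = root_reflection B y z"
    have w: "w \<in> T" "w \<in> R0" using Tr[OF z(1) y] TR by (auto simp: w_def)
    have cw: "cartan_int w z = 2 - cartan_int z y * cartan_int z y"
      using cartan_int_reflection[OF zR zR y] d by (simp add: w_def cartan_int_self[OF zR])
    have "root_reflection B z w = - of_int (cartan_int z y) *\<^sub>R y"
      using c root_reflection_eq[OF zR w(2)] root_reflection_eq[OF y zR]
      unfolding cw w_def[symmetric] by auto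
    then have "- of_int (cartan_int z y) *\<^sub>R y \<in> T" using Tr[OF w(1) zR] by simp
    then show ?thesis using c neg by fastforce
  qed
qed

end

section \<open>Levels of closed subsystems of the affine root system\<close>

locale twisted_affine_roots = irreducible_roots +
  fixes X :: twisted_type and \<delta> :: 'a
  assumes two_lengths: "\<exists>a\<in>R0. \<exists>b\<in>R0. B b b = real (twist_order X) * B a a"
    and \<delta>_notin_span: "\<delta> \<notin> span R0"
    and \<delta>_radical: "B \<delta> x = 0"
begin

abbreviation m :: int where "m \<equiv> int (twist_order X)"
abbreviation \<Phi> :: "'a set" where "\<Phi> \<equiv> affine_roots X B R0 \<delta>"
abbreviation short :: "'a set" where "short \<equiv> short_roots B R0"
abbreviation long :: "'a set" where "long \<equiv> long_roots B R0"

definition levels :: "'a set \<Rightarrow> 'a \<Rightarrow> int set" where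
  "levels \<Delta> \<alpha> = {r. shift \<delta> r \<alpha> \<in> \<Delta>}"

lemma twist_order_cases: "m = 2 \<or> m = 3"
  by (cases X) auto

lemma prime_twist_order: "prime (twist_order X)"
  by (cases X) auto

text \<open>A root \<open>x\<close> is not orthogonal to suitable roots \<open>y\<close> and \<open>z\<close> of the two given lengths \<open>N\<close>
  and \<open>m N\<close>. Both \<open>B x x / N\<close> and \<open>B x x / (m N)\<close> lie in \<open>{1, 2, 3, 1/2, 1/3}\<close>, which leaves only \<open>1\<close> and \<open>m\<close> for the first.\<close>

lemma root_lengths:
  obtains N where "N > 0"
    "short = {x \<in> R0. B x x = N}" "long = {x \<in> R0. B x x = of_int m * N}"
    "R0 = short \<union> long"
proof -
  obtain a b where ab: "a \<in> R0" "b \<in> R0" "B b b = of_int m * B a a" using two_lengths by auto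
  have stable: "reflection_stable {x \<in> R0. B x x = B c c}" if "c \<in> R0" for c
    using that reflection_in_roots B_reflection unfolding reflection_stable_def by auto
  have len: "B x x = B a a \<or> B x x = of_int m * B a a" if x: "x \<in> R0" for x
  proof -
    obtain y where "y \<in> {x \<in> R0. B x x = B a a}" "B y x \<noteq> 0"
      by (rule reflection_stable_not_orthogonal[OF stable[OF ab(1)] x])
    then have y: "B a a = B x x \<or> B a a = 2 * B x x \<or> B a a = 3 * B x x \<or> B x x = 2 * B a a \<or> B x x = 3 * B a a"
      using length_ratio[of y x] x by simp
    obtain z where "z \<in> {x \<in> R0. B x x = B b b}" "B z x \<noteq> 0"
      by (rule reflection_stable_not_orthogonal[OF stable[OF ab(2)] x])
    then have z: "B b b = B x x \<or> B b b = 2 * B x x \<or> B b b = 3 * B x x \<or> B x x = 2 * B b b \<or> B x x = 3 * B b b"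
      using length_ratio[of z x] x by simp
    have "real_of_int m = 2 \<or> real_of_int m = 3" using twist_order_cases by auto
    then show ?thesis
    proof
      assume m: "real_of_int m = 2"
      show ?thesis using y z ab(3) B_pos[OF ab(1)] unfolding m by linarith
    next
      assume m: "real_of_int m = 3"
      show ?thesis using y z ab(3) B_pos[OF ab(1)] unfolding m by linarith
    qed
  qed
  have N: "B a a > 0" using B_pos ab by auto
  have lt: "B a a < of_int m * B a a" using N twist_order_cases by auto
  have s: "short = {x \<in> R0. B x x = B a a}"
    using len lt ab(1) unfolding short_roots_def by fastforce
  have l: "long = {x \<in> R0. B x x = of_int m * B a a}"
    using len lt ab(2,3) unfolding long_roots_def by fastforce
  show ?thesis using that[OF N s l] s l len by blast
qed

lemma short_in: "x \<in> short \<Longrightarrow> x \<in> R0" and long_in: "x \<in> long \<Longrightarrow> x \<in> R0"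
  by (auto simp: short_roots_def long_roots_def)

lemma short_or_long: "x \<in> R0 \<Longrightarrow> x \<in> short \<or> x \<in> long"
  using root_lengths by blast

lemma short_not_long: "x \<in> short \<Longrightarrow> x \<notin> long"
  using root_lengths twist_order_cases by (smt (verit) mem_Collect_eq mult_cancel_right1 of_int_eq_1_iff)

lemma short_length: "x \<in> short \<Longrightarrow> y \<in> R0 \<Longrightarrow> y \<in> short \<longleftrightarrow> B x x = B y y"
  by (rule root_lengths) auto

lemma long_length: "x \<in> long \<Longrightarrow> y \<in> R0 \<Longrightarrow> y \<in> long \<longleftrightarrow> B x x = B y y"
  by (rule root_lengths) auto

lemma long_short_length: "x \<in> long \<Longrightarrow> y \<in> short \<Longrightarrow> B x x = of_int m * B y y"
  by (rule root_lengths) auto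

lemma reflection_short: "y \<in> R0 \<Longrightarrow> x \<in> short \<Longrightarrow> root_reflection B y x \<in> short"
  using short_length[of x "root_reflection B y x"] reflection_in_roots B_reflection short_in by auto

lemma short_nonempty: "short \<noteq> {}" and long_nonempty: "long \<noteq> {}"
proof -
  obtain a b where ab: "a \<in> R0" "b \<in> R0" "B b b = of_int m * B a a" using two_lengths by auto
  obtain N where N: "N > 0" "short = {x \<in> R0. B x x = N}"
    "long = {x \<in> R0. B x x = of_int m * N}" "R0 = short \<union> long" by (rule root_lengths)
  have "B a a \<in> {N, of_int m * N}" "B b b \<in> {N, of_int m * N}" using N ab by blast+
  then have "B a a = N" using ab(3) N(1) twist_order_cases by auto
  then show "short \<noteq> {}" "long \<noteq> {}" using ab N by auto
qed

text \<open>The two pairings \<open>m k\<close> and \<open>k\<close> have a product \<open>m k\<^sup>2 < 4\<close>.\<close>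

lemma cartan_int_long_short:
  assumes x: "x \<in> long" and y: "y \<in> short"
  shows "cartan_int x y = m * cartan_int y x"
    and "B x y \<noteq> 0 \<Longrightarrow> cartan_int y x = 1 \<or> cartan_int y x = - 1"
proof -
  note xy = long_in[OF x] short_in[OF y]
  show eq: "cartan_int x y = m * cartan_int y x"
    using two_B[OF xy] long_short_length[OF x y] sym[of x y]
    by (intro cartan_int_eqI xy) auto
  assume nz: "B x y \<noteq> 0"
  have "x \<noteq> y" "x \<noteq> - y"
    using short_not_long x y short_length[OF y xy(1)] by (auto simp: B_simps)
  then have "m * (cartan_int y x)\<^sup>2 < 4"
    using cartan_int_product_less_4[OF xy] eq by (simp add: power2_eq_square mult.assoc)
  moreover have "2 * (cartan_int y x)\<^sup>2 \<le> m * (cartan_int y x)\<^sup>2"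
    using twist_order_cases by (intro mult_right_mono) auto
  ultimately have "(cartan_int y x)\<^sup>2 < 2\<^sup>2" by simp
  then have "\<bar>cartan_int y x\<bar> < 2"
    using power2_less_imp_less[of "\<bar>cartan_int y x\<bar>" 2] by simp
  moreover have "cartan_int y x \<noteq> 0" using nz cartan_int_eq_0_iff[OF xy] sym[of x y] by simp
  ultimately show "cartan_int y x = 1 \<or> cartan_int y x = - 1" by arith
qed

lemma dvd_cartan_int_long_short: "x \<in> long \<Longrightarrow> y \<in> short \<Longrightarrow> m dvd cartan_int x y"
  by (simp add: cartan_int_long_short)

text \<open>The squared length of the sum is an integer multiple of \<open>B y y\<close>. Were the sum short, it would
  be an integer multiple of \<open>m\<close> times itself.\<close>

lemma long_add_long:
  assumes x: "x \<in> long" and y: "y \<in> long" and xy: "x + y \<in> R0"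
  shows "x + y \<in> long"
proof (rule ccontr)
  assume "x + y \<notin> long"
  then have s: "x + y \<in> short" using short_or_long xy by auto
  have "B (x + y) (x + y) = (2 + of_int (cartan_int x y)) * B y y"
    using two_B[OF long_in[OF y] long_in[OF x]] long_length[OF x long_in[OF y]] y sym[of x y]
    by (simp add: B_simps algebra_simps)
  also have "\<dots> = of_int ((2 + cartan_int x y) * m) * B (x + y) (x + y)"
    using long_short_length[OF y s] by simp
  finally have "of_int ((2 + cartan_int x y) * m) = (1::real)" using B_pos[OF xy] by simp
  then have "(2 + cartan_int x y) * m = 1" by linarith
  then have "m dvd 1" by (metis dvd_triv_right)
  then show False using twist_order_cases by auto
qed

lemma long_add_long_imp_long:
  assumes x: "x \<in> long" and y: "y \<in> R0" and xy: "x + y \<in> long"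
  shows "y \<in> long"
  using long_add_long[OF _ xy, of "- x"] long_length[OF x, of "- x"] minus_in_roots x y long_in
  by (simp add: B_simps)

lemma shift_add: "shift \<delta> r \<alpha> + shift \<delta> s \<beta> = shift \<delta> (r + s) (\<alpha> + \<beta>)"
  by (simp add: shift_def algebra_simps)

lemma shift_eq_in_span:
  assumes "\<alpha> \<in> span R0" "\<beta> \<in> span R0" "shift \<delta> r \<alpha> = shift \<delta> s \<beta>"
  shows "\<alpha> = \<beta> \<and> r = s"
proof -
  have e: "of_int (r - s) *\<^sub>R \<delta> = \<beta> - \<alpha>"
    using assms(3) by (simp add: shift_def algebra_simps)
  have "r = s"
  proof (rule ccontr)
    assume "r \<noteq> s"
    then have "\<delta> = (1 / of_int (r - s)) *\<^sub>R (\<beta> - \<alpha>)" unfolding e[symmetric] by simp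
    then show False using \<delta>_notin_span assms(1,2) by (metis span_diff span_mul)
  qed
  then show ?thesis using e by simp
qed

lemma shift_inject:
  "\<alpha> \<in> R0 \<Longrightarrow> \<beta> \<in> R0 \<Longrightarrow> shift \<delta> r \<alpha> = shift \<delta> s \<beta> \<longleftrightarrow> \<alpha> = \<beta> \<and> r = s"
  using shift_eq_in_span span_base by metis

lemma shift_in_affine_iff:
  assumes "\<alpha> \<in> R0"
  shows "shift \<delta> r \<alpha> \<in> \<Phi> \<longleftrightarrow> \<alpha> \<in> short \<or> m dvd r"
proof
  assume "shift \<delta> r \<alpha> \<in> \<Phi>"
  then consider \<beta> s where "\<beta> \<in> short" "shift \<delta> r \<alpha> = shift \<delta> s \<beta>"
    | \<beta> s where "\<beta> \<in> long" "shift \<delta> r \<alpha> = shift \<delta> (m * s) \<beta>"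
    by (auto simp: affine_roots_def)
  then show "\<alpha> \<in> short \<or> m dvd r"
    by cases (use assms shift_inject short_in long_in in auto)
next
  assume "\<alpha> \<in> short \<or> m dvd r"
  then show "shift \<delta> r \<alpha> \<in> \<Phi>"
    using short_or_long[OF assms] unfolding affine_roots_def dvd_def by blast
qed

lemma affineE:
  assumes "x \<in> \<Phi>"
  obtains \<alpha> r where "\<alpha> \<in> R0" "x = shift \<delta> r \<alpha>" "\<alpha> \<in> short \<or> m dvd r"
proof -
  obtain \<alpha> r where "\<alpha> \<in> R0" "x = shift \<delta> r \<alpha>"
    using assms short_in long_in unfolding affine_roots_def by blast
  then show ?thesis using that assms shift_in_affine_iff by blast
qed

lemma shift_add_in_affine_iff:
  assumes "\<alpha> \<in> R0" "\<beta> \<in> R0"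
  shows "shift \<delta> r \<alpha> + shift \<delta> s \<beta> \<in> \<Phi> \<longleftrightarrow>
    \<alpha> + \<beta> \<in> R0 \<and> (\<alpha> + \<beta> \<in> short \<or> m dvd r + s)"
proof
  assume "shift \<delta> r \<alpha> + shift \<delta> s \<beta> \<in> \<Phi>"
  then obtain \<gamma> t where g: "\<gamma> \<in> R0" "shift \<delta> (r + s) (\<alpha> + \<beta>) = shift \<delta> t \<gamma>" "\<gamma> \<in> short \<or> m dvd t"
    unfolding shift_add by (elim affineE)
  then have "\<alpha> + \<beta> = \<gamma> \<and> r + s = t"
    using shift_eq_in_span[OF span_add[OF span_base span_base] span_base g(2)] assms g(1) by blast
  then show "\<alpha> + \<beta> \<in> R0 \<and> (\<alpha> + \<beta> \<in> short \<or> m dvd r + s)" using g by simp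
qed (simp add: shift_add shift_in_affine_iff)

lemma reflection_shift:
  assumes "\<alpha> \<in> R0" "\<beta> \<in> R0"
  shows "root_reflection B (shift \<delta> r \<alpha>) (shift \<delta> s \<beta>)
    = shift \<delta> (s - cartan_int \<beta> \<alpha> * r) (root_reflection B \<alpha> \<beta>)"
proof -
  have "B (shift \<delta> s x) (shift \<delta> t y) = B x y" for s t x y
    using \<delta>_radical sym[of _ \<delta>] by (simp add: shift_def B_simps)
  then have "cartan_pairing B (shift \<delta> s \<beta>) (shift \<delta> r \<alpha>) = of_int (cartan_int \<beta> \<alpha>)"
    using of_int_cartan_int[OF assms] by (simp add: cartan_pairing_def)
  then have "root_reflection B (shift \<delta> r \<alpha>) (shift \<delta> s \<beta>)
      = shift \<delta> s \<beta> - of_int (cartan_int \<beta> \<alpha>) *\<^sub>R shift \<delta> r \<alpha>"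
    by (simp add: root_reflection_def)
  then show ?thesis unfolding root_reflection_eq[OF assms]
    by (simp add: shift_def algebra_simps)
qed

lemma reflection_level_in_affine:
  assumes "\<alpha> \<in> R0" "\<beta> \<in> R0" "\<alpha> \<in> short \<or> m dvd r" "\<beta> \<in> short \<or> m dvd s"
  shows "root_reflection B \<alpha> \<beta> \<in> short \<or> m dvd s - cartan_int \<beta> \<alpha> * r"
proof (cases "\<beta> \<in> short")
  case True
  then show ?thesis using reflection_short assms(1) by simp
next
  case False
  then have "\<beta> \<in> long" "m dvd s" using assms short_or_long by auto
  moreover have "m dvd cartan_int \<beta> \<alpha> * r"
    using assms(3) dvd_cartan_int_long_short[OF \<open>\<beta> \<in> long\<close>] by (meson dvd_mult dvd_mult2)
  ultimately show ?thesis by simp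
qed

text \<open>For a subsystem that is cut out of \<open>\<Phi>\<close> by a condition \<open>Q\<close> on root and level, the constraint
  that \<open>\<Phi>\<close> puts on levels takes care of itself: reflections preserve it, and closedness concerns only
  sums in \<open>\<Phi>\<close>.\<close>

lemma closed_subroot_system_levelsI:
  assumes eq: "\<Delta> = {shift \<delta> r \<alpha> | \<alpha> r. \<alpha> \<in> R0 \<and> (\<alpha> \<in> short \<or> m dvd r) \<and> Q \<alpha> r}"
    and ne: "\<Delta> \<noteq> {}"
    and refl: "\<And>\<alpha> \<beta> r s. \<alpha> \<in> R0 \<Longrightarrow> \<beta> \<in> R0 \<Longrightarrow> Q \<alpha> r \<Longrightarrow> Q \<beta> s \<Longrightarrow>
      Q (root_reflection B \<alpha> \<beta>) (s - cartan_int \<beta> \<alpha> * r)"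
    and add: "\<And>\<alpha> \<beta> r s. \<alpha> \<in> R0 \<Longrightarrow> \<beta> \<in> R0 \<Longrightarrow> Q \<alpha> r \<Longrightarrow> Q \<beta> s \<Longrightarrow> \<alpha> + \<beta> \<in> R0 \<Longrightarrow>
      Q (\<alpha> + \<beta>) (r + s)"
  shows "closed_subroot_system B \<Phi> \<Delta>"
  unfolding closed_subroot_system_def subroot_system_def
proof (intro conjI ballI impI)
  show "\<Delta> \<noteq> {}" by fact
  show "\<Delta> \<subseteq> \<Phi>" unfolding eq using shift_in_affine_iff by auto
next
  fix x y assume "x \<in> \<Delta>" "y \<in> \<Delta>"
  then obtain \<alpha> r \<beta> s where x: "x = shift \<delta> r \<alpha>" "\<alpha> \<in> R0" "\<alpha> \<in> short \<or> m dvd r" "Q \<alpha> r"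
    and y: "y = shift \<delta> s \<beta>" "\<beta> \<in> R0" "\<beta> \<in> short \<or> m dvd s" "Q \<beta> s"
    unfolding eq by blast
  show "root_reflection B x y \<in> \<Delta>"
    unfolding x(1) y(1) reflection_shift[OF x(2) y(2)] eq
    using reflection_level_in_affine[OF x(2) y(2) x(3) y(3)] reflection_in_roots[OF x(2) y(2)]
      refl[OF x(2) y(2) x(4) y(4)] by blast
  show "x + y \<in> \<Delta>" if "x + y \<in> \<Phi>"
    using that unfolding x(1) y(1) shift_add_in_affine_iff[OF x(2) y(2)]
    unfolding shift_add eq using add[OF x(2) y(2) x(4) y(4)] by blast
qed

context
  fixes \<Delta> :: "'a set"
  assumes closed: "closed_subroot_system B \<Phi> \<Delta>"
begin

lemma subset_affine: "\<Delta> \<subseteq> \<Phi>"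
  using closed by (simp add: closed_subroot_system_def subroot_system_def)

lemma mem_gradient: "\<alpha> \<in> gradient R0 \<delta> \<Delta> \<longleftrightarrow> \<alpha> \<in> R0 \<and> levels \<Delta> \<alpha> \<noteq> {}"
  by (auto simp: gradient_def levels_def)

lemma level_in_affine: "\<alpha> \<in> R0 \<Longrightarrow> r \<in> levels \<Delta> \<alpha> \<Longrightarrow> \<alpha> \<in> short \<or> m dvd r"
  using subset_affine shift_in_affine_iff unfolding levels_def by auto

lemma levels_long: "\<alpha> \<in> long \<Longrightarrow> r \<in> levels \<Delta> \<alpha> \<Longrightarrow> m dvd r"
  using level_in_affine long_in short_not_long by blast

lemma levels_reflection:
  assumes "\<alpha> \<in> R0" "\<beta> \<in> R0" "r \<in> levels \<Delta> \<alpha>" "s \<in> levels \<Delta> \<beta>"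
  shows "s - cartan_int \<beta> \<alpha> * r \<in> levels \<Delta> (root_reflection B \<alpha> \<beta>)"
  using closed assms reflection_shift[OF assms(1,2), of r s]
  unfolding closed_subroot_system_def subroot_system_def levels_def by (metis mem_Collect_eq)

lemma levels_add:
  assumes "\<alpha> \<in> R0" "\<beta> \<in> R0" "r \<in> levels \<Delta> \<alpha>" "s \<in> levels \<Delta> \<beta>" "\<alpha> + \<beta> \<in> R0"
    "\<alpha> + \<beta> \<in> short \<or> m dvd r + s"
  shows "r + s \<in> levels \<Delta> (\<alpha> + \<beta>)"
  using closed assms shift_add_in_affine_iff[OF assms(1,2), of r s] shift_add[of r \<alpha> s \<beta>]
  unfolding closed_subroot_system_def levels_def by (metis mem_Collect_eq)

lemma levels_uminus:
  assumes "\<alpha> \<in> R0" "r \<in> levels \<Delta> \<alpha>"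
  shows "- r \<in> levels \<Delta> (- \<alpha>)"
  using levels_reflection[OF assms(1,1,2,2)] reflection_self[OF assms(1)] cartan_int_self[OF assms(1)]
  by simp

lemma levels_point_reflection:
  assumes "\<alpha> \<in> R0" "r \<in> levels \<Delta> \<alpha>" "s \<in> levels \<Delta> \<alpha>"
  shows "2 * r - s \<in> levels \<Delta> \<alpha>"
  using levels_uminus[OF minus_in_roots[OF assms(1)], of "s - 2 * r"]
    levels_reflection[OF assms(1,1,2,3)] reflection_self[OF assms(1)] cartan_int_self[OF assms(1)]
  by simp

text \<open>Two successive reflections in affine roots with the same finite part \<open>\<gamma>\<close> compose to a
  translation of the levels.\<close>

lemma levels_translation:
  assumes "\<gamma> \<in> R0" "\<beta> \<in> R0" "r \<in> levels \<Delta> \<gamma>" "s \<in> levels \<Delta> \<gamma>" "t \<in> levels \<Delta> \<beta>"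
  shows "t + cartan_int \<beta> \<gamma> * (r - s) \<in> levels \<Delta> \<beta>"
  using levels_reflection[OF assms(1) reflection_in_roots[OF assms(1,2)] assms(3)
      levels_reflection[OF assms(1,2) assms(4,5)]]
    reflection_involution[OF assms(1,2)] cartan_int_reflection_self[OF assms(1,2)]
  by (simp add: algebra_simps)

lemma gradient_reflection:
  assumes "\<alpha> \<in> gradient R0 \<delta> \<Delta>" "\<beta> \<in> gradient R0 \<delta> \<Delta>"
  shows "root_reflection B \<alpha> \<beta> \<in> gradient R0 \<delta> \<Delta>"
  using assms reflection_in_roots levels_reflection unfolding mem_gradient by blast

lemma levels_UNIV_reflection:
  assumes "\<alpha> \<in> gradient R0 \<delta> \<Delta>" "\<beta> \<in> R0" "levels \<Delta> \<beta> = UNIV"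
  shows "levels \<Delta> (root_reflection B \<alpha> \<beta>) = UNIV"
proof -
  obtain r where r: "\<alpha> \<in> R0" "r \<in> levels \<Delta> \<alpha>" using assms(1) mem_gradient by auto
  have "s \<in> levels \<Delta> (root_reflection B \<alpha> \<beta>)" for s
    using levels_reflection[OF r(1) assms(2) r(2), of "s + cartan_int \<beta> \<alpha> * r"] assms(3) by simp
  then show ?thesis by auto
qed

text \<open>If one short root occurs at all levels, then by transitivity all short roots do, and the
  translations by a short root shift the levels of a long root that is not orthogonal to it by all
  multiples of \<open>m\<close>.\<close>

lemma eq_affine_if_short_levels_UNIV:
  assumes grad: "gradient R0 \<delta> \<Delta> = R0" and \<gamma>: "\<gamma> \<in> short" "levels \<Delta> \<gamma> = UNIV"
  shows "\<Delta> = \<Phi>"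
proof
  show "\<Delta> \<subseteq> \<Phi>" by (rule subset_affine)
  have "reflection_stable {x \<in> R0. levels \<Delta> x = UNIV}"
    unfolding reflection_stable_def
    using \<gamma> short_in reflection_in_roots levels_UNIV_reflection grad by auto
  then have s: "levels \<Delta> \<alpha> = UNIV" if "\<alpha> \<in> short" for \<alpha>
    using reflection_stable_equal_length[of _ \<gamma> \<alpha>] \<gamma> that short_in short_length[OF \<gamma>(1)] by blast
  have stable: "reflection_stable short"
    unfolding reflection_stable_def using short_nonempty short_in reflection_short by blast
  have l: "r \<in> levels \<Delta> \<beta>" if \<beta>: "\<beta> \<in> long" and r: "m dvd r" for \<beta> r
  proof -
    note \<beta>R = long_in[OF \<beta>]
    obtain \<alpha> where \<alpha>: "\<alpha> \<in> short" "B \<alpha> \<beta> \<noteq> 0"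
      using reflection_stable_not_orthogonal[OF stable \<beta>R] .
    obtain t where t: "t \<in> levels \<Delta> \<beta>" using grad \<beta>R mem_gradient by blast
    (* Translating t by k times the pairing m c with \<alpha> reaches r, as c is a unit. *)
    obtain k where k: "r - t = m * k" using r levels_long[OF \<beta> t] by (metis dvd_diff dvd_def)
    define c where "c = cartan_int \<alpha> \<beta>"
    have c: "c * c = 1" "cartan_int \<beta> \<alpha> = m * c"
      using cartan_int_long_short[OF \<beta> \<alpha>(1)] \<alpha>(2) sym[of \<alpha> \<beta>] by (auto simp: c_def)
    have "t + cartan_int \<beta> \<alpha> * (c * k - 0) \<in> levels \<Delta> \<beta>"
      using levels_translation[OF short_in[OF \<alpha>(1)] \<beta>R _ _ t] s[OF \<alpha>(1)] by blast
    moreover have e: "t + cartan_int \<beta> \<alpha> * (c * k - 0) = t + m * (c * c) * k"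
      unfolding c(2) by (simp add: algebra_simps)
    ultimately have "t + m * (c * c) * k \<in> levels \<Delta> \<beta>" by (simp only: e)
    then have "t + m * k \<in> levels \<Delta> \<beta>" by (simp add: c(1))
    then show ?thesis by (simp flip: k)
  qed
  show "\<Phi> \<subseteq> \<Delta>"
  proof
    fix x assume "x \<in> \<Phi>"
    then obtain \<alpha> r where x: "\<alpha> \<in> R0" "x = shift \<delta> r \<alpha>" "\<alpha> \<in> short \<or> m dvd r" by (rule affineE)
    then have "r \<in> levels \<Delta> \<alpha>" using s l short_or_long by blast
    then show "x \<in> \<Delta>" using x by (simp add: levels_def)
  qed
qed

end

section \<open>Subsystems with full gradient\<close>

text \<open>On long roots \<open>m\<close> divides both \<open>r\<close> and \<open>p \<alpha>\<close>. Together with \<open>q\<close> dividing \<open>r - p \<alpha>\<close> this means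
  a step of \<open>m q\<close> if \<open>q \<noteq> m\<close>, and of \<open>m\<close> if \<open>q = m\<close>, so one condition covers both cases of the
  definition.\<close>

lemma full_gradient_subsystem_eq:
  assumes q: "prime q" and p: "\<forall>\<alpha>\<in>long. m dvd p \<alpha>"
  shows "full_gradient_subsystem X B R0 \<delta> q p
    = {shift \<delta> r \<alpha> | \<alpha> r. \<alpha> \<in> R0 \<and> (\<alpha> \<in> short \<or> m dvd r) \<and> int q dvd r - p \<alpha>}"
    (is "_ = ?F")
proof (cases "twist_order X = q")
  case True
  have "full_gradient_subsystem X B R0 \<delta> q p = {shift \<delta> (p \<alpha> + r * m) \<alpha> | \<alpha> r. \<alpha> \<in> R0}"
    using True by (simp add: full_gradient_subsystem_def)
  also have "\<dots> = ?F"
  proof (intro equalityI subsetI)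
    fix x assume "x \<in> {shift \<delta> (p \<alpha> + r * m) \<alpha> | \<alpha> r. \<alpha> \<in> R0}"
    then obtain \<alpha> r where x: "\<alpha> \<in> R0" "x = shift \<delta> (p \<alpha> + r * m) \<alpha>" by blast
    then show "x \<in> ?F"
      using p short_or_long[OF x(1)] True by (intro CollectI exI[of _ \<alpha>] exI[of _ "p \<alpha> + r * m"]) auto
  next
    fix x assume "x \<in> ?F"
    then obtain \<alpha> r where x: "\<alpha> \<in> R0" "x = shift \<delta> r \<alpha>" "m dvd r - p \<alpha>" using True by blast
    then obtain k where "r = p \<alpha> + k * m" by (metis add_diff_cancel_left' diff_add_cancel dvdE mult.commute add.commute)
    then show "x \<in> {shift \<delta> (p \<alpha> + r * m) \<alpha> | \<alpha> r. \<alpha> \<in> R0}" using x by blast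
  qed
  finally show ?thesis .
next
  case False
  have cop: "coprime m (int q)"
    using primes_coprime[OF prime_twist_order q False] by simp
  have "full_gradient_subsystem X B R0 \<delta> q p
    = {shift \<delta> (p \<alpha> + r * int q) \<alpha> | \<alpha> r. \<alpha> \<in> short} \<union> {shift \<delta> (p \<beta> + m * r * int q) \<beta> | \<beta> r. \<beta> \<in> long}"
    using False by (simp add: full_gradient_subsystem_def)
  also have "\<dots> = ?F"
  proof (intro equalityI subsetI)
    fix x assume "x \<in> {shift \<delta> (p \<alpha> + r * int q) \<alpha> | \<alpha> r. \<alpha> \<in> short} \<union>
      {shift \<delta> (p \<beta> + m * r * int q) \<beta> | \<beta> r. \<beta> \<in> long}"
    then consider \<alpha> r where "\<alpha> \<in> short" "x = shift \<delta> (p \<alpha> + r * int q) \<alpha>"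
      | \<alpha> r where "\<alpha> \<in> long" "x = shift \<delta> (p \<alpha> + m * r * int q) \<alpha>" by blast
    then show "x \<in> ?F"
    proof cases
      case (1 \<alpha> r)
      then show ?thesis
        using short_in by (intro CollectI exI[of _ \<alpha>] exI[of _ "p \<alpha> + r * int q"]) auto
    next
      case (2 \<alpha> r)
      then show ?thesis
        using long_in p by (intro CollectI exI[of _ \<alpha>] exI[of _ "p \<alpha> + m * r * int q"]) auto
    qed
  next
    fix x assume "x \<in> ?F"
    then obtain \<alpha> r where x: "\<alpha> \<in> R0" "x = shift \<delta> r \<alpha>" "\<alpha> \<in> short \<or> m dvd r" "int q dvd r - p \<alpha>"
      by blast
    show "x \<in> {shift \<delta> (p \<alpha> + r * int q) \<alpha> | \<alpha> r. \<alpha> \<in> short} \<union>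
      {shift \<delta> (p \<beta> + m * r * int q) \<beta> | \<beta> r. \<beta> \<in> long}"
    proof (cases "\<alpha> \<in> short")
      case True
      obtain k where "r - p \<alpha> = int q * k" using x(4) by (elim dvdE)
      then have "r = p \<alpha> + k * int q" by (simp add: algebra_simps)
      then show ?thesis using x True by blast
    next
      case False
      then have l: "\<alpha> \<in> long" using x short_or_long by auto
      then have "m dvd r - p \<alpha>" using False x p by (intro dvd_diff) auto
      then have "m * int q dvd r - p \<alpha>" using cop x(4) by (simp add: divides_mult)
      then obtain k where "r - p \<alpha> = m * int q * k" by (elim dvdE)
      then have "r = p \<alpha> + m * k * int q" by (simp add: algebra_simps)
      then show ?thesis using x l by blast
    qed
  qed
  finally show ?thesis .
qed

context
  fixes p :: "'a \<Rightarrow> int"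
  assumes p: "translate_conditions X B R0 p"
begin

lemma translate_long: "\<alpha> \<in> long \<Longrightarrow> m dvd p \<alpha>"
  using p by (simp add: translate_conditions_def)

lemma translate_reflection:
  assumes "\<alpha> \<in> R0" "\<beta> \<in> R0"
  shows "p (root_reflection B \<alpha> \<beta>) = p \<beta> - cartan_int \<beta> \<alpha> * p \<alpha>"
proof -
  have "real_of_int (p \<beta> - cartan_int \<beta> \<alpha> * p \<alpha>) = of_int (p (root_reflection B \<alpha> \<beta>))"
    using p assms of_int_cartan_int[OF assms] by (simp add: translate_conditions_def)
  then show ?thesis by linarith
qed

lemma translate_add:
  assumes "\<alpha> \<in> R0" "\<beta> \<in> R0" "\<alpha> + \<beta> \<in> R0"
  shows "p (\<alpha> + \<beta>) = p \<alpha> + p \<beta>"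
  using p assms unfolding translate_conditions_def Z_linear_on_def
  by (metis group_closure.base insertCI)

lemma full_eq:
  assumes "prime q"
  shows "full_gradient_subsystem X B R0 \<delta> q p
    = {shift \<delta> r \<alpha> | \<alpha> r. \<alpha> \<in> R0 \<and> (\<alpha> \<in> short \<or> m dvd r) \<and> int q dvd r - p \<alpha>}"
  using full_gradient_subsystem_eq[OF assms] translate_long by blast

lemma levels_full:
  assumes "prime q" "\<alpha> \<in> R0"
  shows "r \<in> levels (full_gradient_subsystem X B R0 \<delta> q p) \<alpha> \<longleftrightarrow>
    (\<alpha> \<in> short \<or> m dvd r) \<and> int q dvd r - p \<alpha>"
proof
  assume "r \<in> levels (full_gradient_subsystem X B R0 \<delta> q p) \<alpha>"
  then obtain \<alpha>' r' where "shift \<delta> r \<alpha> = shift \<delta> r' \<alpha>'" "\<alpha>' \<in> R0" "\<alpha>' \<in> short \<or> m dvd r'"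
    "int q dvd r' - p \<alpha>'"
    unfolding levels_def full_eq[OF assms(1)] by blast
  then show "(\<alpha> \<in> short \<or> m dvd r) \<and> int q dvd r - p \<alpha>"
    using shift_inject[OF assms(2), of \<alpha>' r r'] by simp
next
  assume "(\<alpha> \<in> short \<or> m dvd r) \<and> int q dvd r - p \<alpha>"
  then show "r \<in> levels (full_gradient_subsystem X B R0 \<delta> q p) \<alpha>"
    unfolding levels_def full_eq[OF assms(1)] using assms(2) by blast
qed

lemma translate_in_levels_full:
  assumes "prime q" "\<alpha> \<in> R0"
  shows "p \<alpha> \<in> levels (full_gradient_subsystem X B R0 \<delta> q p) \<alpha>"
  using levels_full[OF assms] translate_long short_or_long[OF assms(2)] by auto

lemma closed_full:
  assumes q: "prime q"
  shows "closed_subroot_system B \<Phi> (full_gradient_subsystem X B R0 \<delta> q p)"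
proof (rule closed_subroot_system_levelsI[OF full_eq[OF q]])
  obtain \<alpha> where "\<alpha> \<in> short" using short_nonempty by auto
  then have "p \<alpha> \<in> levels (full_gradient_subsystem X B R0 \<delta> q p) \<alpha>"
    using translate_in_levels_full[OF q] short_in by auto
  then show "full_gradient_subsystem X B R0 \<delta> q p \<noteq> {}" by (auto simp: levels_def)
next
  fix \<alpha> \<beta> r s
  assume ab: "\<alpha> \<in> R0" "\<beta> \<in> R0" and d: "int q dvd r - p \<alpha>" "int q dvd s - p \<beta>"
  have e: "s - cartan_int \<beta> \<alpha> * r - p (root_reflection B \<alpha> \<beta>)
      = (s - p \<beta>) - cartan_int \<beta> \<alpha> * (r - p \<alpha>)"
    by (simp add: translate_reflection[OF ab] algebra_simps)
  show "int q dvd s - cartan_int \<beta> \<alpha> * r - p (root_reflection B \<alpha> \<beta>)"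
    unfolding e using d by (metis dvd_diff dvd_mult)
  have e': "r + s - (p \<alpha> + p \<beta>) = (r - p \<alpha>) + (s - p \<beta>)" by simp
  then show "int q dvd r + s - p (\<alpha> + \<beta>)" if "\<alpha> + \<beta> \<in> R0"
    unfolding translate_add[OF ab that] e' using dvd_add[OF d] by simp
qed

lemma full_proper:
  assumes q: "prime q"
  shows "full_gradient_subsystem X B R0 \<delta> q p \<subset> \<Phi>"
proof -
  obtain \<alpha> where \<alpha>: "\<alpha> \<in> short" using short_nonempty by auto
  have "p \<alpha> + 1 \<notin> levels (full_gradient_subsystem X B R0 \<delta> q p) \<alpha>"
    using levels_full[OF q short_in[OF \<alpha>]] q by (auto dest: not_prime_unit)
  then have "shift \<delta> (p \<alpha> + 1) \<alpha> \<notin> full_gradient_subsystem X B R0 \<delta> q p" by (simp add: levels_def)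
  moreover have "shift \<delta> (p \<alpha> + 1) \<alpha> \<in> \<Phi>" using \<alpha> shift_in_affine_iff short_in by simp
  ultimately show ?thesis using subset_affine[OF closed_full[OF q]] by blast
qed

text \<open>The levels of a short root relative to \<open>p\<close> are the multiples of one \<open>d\<close>, the same for all
  short roots by transitivity. A relative level \<open>r\<close> of a long root is also a relative level of
  the short roots, because reflecting in the long root moves suitable short roots by \<open>\<plusminus>r\<close>.
  So any prime divisor of \<open>d\<close> works, and \<open>d\<close> is not a unit, as a short root would then have all
  levels.\<close>

lemma subset_full_if_translate_in_levels:
  assumes closed: "closed_subroot_system B \<Phi> \<Delta>" and proper: "\<Delta> \<noteq> \<Phi>"
    and base: "\<And>\<alpha>. \<alpha> \<in> R0 \<Longrightarrow> p \<alpha> \<in> levels \<Delta> \<alpha>"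
  obtains q where "prime q" "\<Delta> \<subseteq> full_gradient_subsystem X B R0 \<delta> q p"
proof -
  define L where "L \<alpha> = {r. r + p \<alpha> \<in> levels \<Delta> \<alpha>}" for \<alpha>
  have L0: "0 \<in> L \<alpha>" if "\<alpha> \<in> R0" for \<alpha> using base[OF that] by (simp add: L_def)
  have chain: "2 * r - s \<in> L \<alpha>" if "\<alpha> \<in> R0" "r \<in> L \<alpha>" "s \<in> L \<alpha>" for \<alpha> r s
    using levels_point_reflection[OF closed that(1), of "r + p \<alpha>" "s + p \<alpha>"] that
    by (simp add: L_def algebra_simps)
  have refl: "s - cartan_int \<beta> \<alpha> * r \<in> L (root_reflection B \<alpha> \<beta>)"
    if "\<alpha> \<in> R0" "\<beta> \<in> R0" "r \<in> L \<alpha>" "s \<in> L \<beta>" for \<alpha> \<beta> r s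
  proof -
    have e: "s - cartan_int \<beta> \<alpha> * r + p (root_reflection B \<alpha> \<beta>)
        = s + p \<beta> - cartan_int \<beta> \<alpha> * (r + p \<alpha>)"
      unfolding translate_reflection[OF that(1,2)] by (simp add: algebra_simps)
    show ?thesis
      unfolding L_def mem_Collect_eq e
      using levels_reflection[OF closed that(1,2), of "r + p \<alpha>" "s + p \<beta>"] that
      by (simp add: L_def)
  qed
  obtain \<alpha>0 where \<alpha>0: "\<alpha>0 \<in> short" "\<alpha>0 \<in> R0" using short_nonempty short_in by auto
  have short: "r \<in> L \<alpha>0" if "\<alpha> \<in> short" "r \<in> L \<alpha>" for \<alpha> r
  proof -
    have "reflection_stable {x \<in> R0. r \<in> L x}"
      unfolding reflection_stable_def
      using that short_in reflection_in_roots refl[OF _ _ L0] by fastforce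
    then show ?thesis
      using reflection_stable_equal_length[of _ \<alpha> \<alpha>0] that short_in \<alpha>0 short_length[OF that(1)] by blast
  qed
  have long: "r \<in> L \<alpha>0" if \<beta>: "\<beta> \<in> long" and r: "r \<in> L \<beta>" for \<beta> r
  proof -
    have "reflection_stable short"
      unfolding reflection_stable_def using short_nonempty short_in reflection_short by blast
    then obtain \<alpha> where \<alpha>: "\<alpha> \<in> short" "B \<alpha> \<beta> \<noteq> 0"
      using reflection_stable_not_orthogonal[OF _ long_in[OF \<beta>]] by blast
    have c: "cartan_int \<alpha> \<beta> = 1 \<or> cartan_int \<alpha> \<beta> = - 1"
      using cartan_int_long_short(2)[OF \<beta> \<alpha>(1)] \<alpha>(2) sym[of \<alpha> \<beta>] by simp
    have "0 - cartan_int \<alpha> \<beta> * r \<in> L (root_reflection B \<beta> \<alpha>)"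
      using refl[OF long_in[OF \<beta>] short_in[OF \<alpha>(1)] r L0] short_in[OF \<alpha>(1)] by blast
    then have "- cartan_int \<alpha> \<beta> * r \<in> L \<alpha>0"
      using short[OF reflection_short[OF long_in[OF \<beta>] \<alpha>(1)]] by simp
    then show ?thesis using c chain[OF \<alpha>0(2) L0[OF \<alpha>0(2)], of "- r"] by auto
  qed
  obtain d where d: "L \<alpha>0 = {r. d dvd r}"
    using reflection_closed_int_set[of "L \<alpha>0"] L0 chain \<alpha>0(2) by blast
  have "\<not> d dvd 1"
  proof
    assume "d dvd 1"
    then have L: "L \<alpha>0 = UNIV" using d by (auto intro: dvd_trans)
    have "r \<in> levels \<Delta> \<alpha>0" for r
    proof -
      have "r - p \<alpha>0 \<in> L \<alpha>0" using L by simp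
      then show ?thesis by (simp add: L_def)
    qed
    moreover have "gradient R0 \<delta> \<Delta> = R0" using base mem_gradient[OF closed] by blast
    ultimately show False using eq_affine_if_short_levels_UNIV[OF closed _ \<alpha>0(1)] proper by blast
  qed
  then have "nat \<bar>d\<bar> \<noteq> 1" by (simp add: zdvd1_eq nat_eq_iff)
  then obtain q where q: "prime q" "q dvd nat \<bar>d\<bar>" using prime_factor_nat by blast
  have "int q dvd d" using q(2) by (metis abs_ge_zero dvd_abs_iff int_dvd_int_iff int_nat_eq)
  have "\<Delta> \<subseteq> full_gradient_subsystem X B R0 \<delta> q p"
  proof
    fix x assume x: "x \<in> \<Delta>"
    then obtain \<alpha> r where xr: "\<alpha> \<in> R0" "x = shift \<delta> r \<alpha>" "\<alpha> \<in> short \<or> m dvd r"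
      using subset_affine[OF closed] affineE by blast
    have "r - p \<alpha> \<in> L \<alpha>" using x xr by (simp add: L_def levels_def)
    then have "d dvd r - p \<alpha>" using short long short_or_long[OF xr(1)] d by blast
    then have "int q dvd r - p \<alpha>" using \<open>int q dvd d\<close> dvd_trans by blast
    then show "x \<in> full_gradient_subsystem X B R0 \<delta> q p"
      unfolding full_eq[OF q(1)] using xr by blast
  qed
  then show ?thesis using that q by blast
qed

text \<open>A larger proper system lies in the system of the same \<open>p\<close> and a prime \<open>q'\<close>. This contains a
  short root at level \<open>p + q\<close>, so that \<open>q'\<close> divides \<open>q\<close>.\<close>

lemma maximal_full:
  assumes q: "prime q"
  shows "maximal_closed_subroot_system B \<Phi> (full_gradient_subsystem X B R0 \<delta> q p)"
  unfolding maximal_closed_subroot_system_def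
proof (intro conjI allI impI)
  show "closed_subroot_system B \<Phi> (full_gradient_subsystem X B R0 \<delta> q p)"
    and "full_gradient_subsystem X B R0 \<delta> q p \<subset> \<Phi>"
    using closed_full full_proper q by auto
  fix \<Delta> assume \<Delta>: "closed_subroot_system B \<Phi> \<Delta> \<and>
    full_gradient_subsystem X B R0 \<delta> q p \<subseteq> \<Delta> \<and> \<Delta> \<subset> \<Phi>"
  then have "p \<alpha> \<in> levels \<Delta> \<alpha>" if "\<alpha> \<in> R0" for \<alpha>
    using translate_in_levels_full[OF q that] by (auto simp: levels_def)
  then obtain q' where q': "prime q'" "\<Delta> \<subseteq> full_gradient_subsystem X B R0 \<delta> q' p"
    using subset_full_if_translate_in_levels \<Delta> by blast
  obtain \<alpha> where \<alpha>: "\<alpha> \<in> short" using short_nonempty by auto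
  have "p \<alpha> + int q \<in> levels (full_gradient_subsystem X B R0 \<delta> q p) \<alpha>"
    using levels_full[OF q short_in[OF \<alpha>]] \<alpha> by simp
  then have "p \<alpha> + int q \<in> levels (full_gradient_subsystem X B R0 \<delta> q' p) \<alpha>"
    using \<Delta> q'(2) by (auto simp: levels_def)
  then have "q' dvd q" using levels_full[OF q'(1) short_in[OF \<alpha>]] by simp
  then have "q' = q" using q q'(1) primes_dvd_imp_eq by blast
  then show "\<Delta> = full_gradient_subsystem X B R0 \<delta> q p" using \<Delta> q'(2) by blast
qed

end

text \<open>Choose a level of each simple root and extend linearly. The roots that occur in \<open>\<Delta>\<close> at the
  level prescribed by this extension are stable under reflections in each other. A
  positive root that is not simple loses height when it is reflected in a simple root with which it
  makes an acute angle, so induction on the height reaches all roots.\<close>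

lemma translate_exists:
  assumes simple: "simple_roots R0 n a"
    and closed: "closed_subroot_system B \<Phi> \<Delta>" and grad: "gradient R0 \<delta> \<Delta> = R0"
  obtains p where "translate_conditions X B R0 p" "\<And>\<alpha>. \<alpha> \<in> R0 \<Longrightarrow> p \<alpha> \<in> levels \<Delta> \<alpha>"
proof -
  have inj: "inj_on a {1..n}" and indep: "independent (a ` {1..n})" and aR: "\<And>i. i \<in> {1..n} \<Longrightarrow> a i \<in> R0"
    and comb: "\<And>\<beta>. \<beta> \<in> R0 \<Longrightarrow> \<exists>c::nat \<Rightarrow> nat.
        \<beta> = (\<Sum>i=1..n. real (c i) *\<^sub>R a i) \<or> \<beta> = - (\<Sum>i=1..n. real (c i) *\<^sub>R a i)"
    using simple unfolding simple_roots_def by auto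
  define l where "l x = (SOME r. r \<in> levels \<Delta> x)" for x
  have l: "l \<alpha> \<in> levels \<Delta> \<alpha>" if "\<alpha> \<in> R0" for \<alpha>
    unfolding l_def using that grad mem_gradient[OF closed] by (metis ex_in_conv someI_ex)
  obtain g where g: "linear g" "\<And>x. x \<in> a ` {1..n} \<Longrightarrow> g x = real_of_int (l x)"
    using linear_independent_extend[OF indep, of "\<lambda>x. real_of_int (l x)"] by blast
  (* the height *)
  obtain h where h: "linear h" "\<And>x. x \<in> a ` {1..n} \<Longrightarrow> h x = (1::real)"
    using linear_independent_extend[OF indep, of "\<lambda>x. 1::real"] by blast
  have gcomb: "g (\<Sum>i=1..n. real (c i) *\<^sub>R a i) = of_int (\<Sum>i=1..n. int (c i) * l (a i))" for c :: "nat \<Rightarrow> nat"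
    using g by (simp add: linear_sum linear_scale)
  have hcomb: "h (\<Sum>i=1..n. real (c i) *\<^sub>R a i) = real (\<Sum>i=1..n. c i)" for c :: "nat \<Rightarrow> nat"
    using h by (simp add: linear_sum linear_scale)
  have gR: "g \<alpha> \<in> \<int>" if "\<alpha> \<in> R0" for \<alpha>
  proof -
    obtain c :: "nat \<Rightarrow> nat" where
      "\<alpha> = (\<Sum>i=1..n. real (c i) *\<^sub>R a i) \<or> \<alpha> = - (\<Sum>i=1..n. real (c i) *\<^sub>R a i)"
      using comb[OF \<open>\<alpha> \<in> R0\<close>] by blast
    then have "g \<alpha> = of_int (\<Sum>i=1..n. int (c i) * l (a i)) \<or> g \<alpha> = - of_int (\<Sum>i=1..n. int (c i) * l (a i))"
      by (elim disjE) (simp_all only: gcomb linear_neg[OF g(1)], simp_all)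
    then show ?thesis using Ints_of_int Ints_minus by metis
  qed
  have gI: "g x \<in> \<int>" if "x \<in> group_closure R0" for x
    using that
  proof induction
    case (base s)
    then show ?case using gR linear_0[OF g(1)] by auto
  next
    case (diff s t)
    then show ?case using linear_diff[OF g(1)] by simp
  qed
  (* g is integral on the root lattice, so the floor only changes the type there. *)
  define p where "p x = \<lfloor>g x\<rfloor>" for x
  have p: "real_of_int (p x) = g x" if "x \<in> group_closure R0" for x
    using gI[OF that] by (simp add: p_def)
  have pR: "real_of_int (p x) = g x" if "x \<in> R0" for x
    using p that by (simp add: group_closure.base)
  have p_refl: "of_int (p \<beta>) - cartan_pairing B \<beta> \<alpha> * of_int (p \<alpha>) = of_int (p (root_reflection B \<alpha> \<beta>))"
    if "\<alpha> \<in> R0" "\<beta> \<in> R0" for \<alpha> \<beta>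
    using pR[OF that(1)] pR[OF that(2)] pR[OF reflection_in_roots[OF that]] linear_diff[OF g(1)]
      linear_scale[OF g(1)]
    by (simp add: root_reflection_def)
  have p_refl': "p (root_reflection B \<alpha> \<beta>) = p \<beta> - cartan_int \<beta> \<alpha> * p \<alpha>"
    if "\<alpha> \<in> R0" "\<beta> \<in> R0" for \<alpha> \<beta>
  proof -
    have "real_of_int (p (root_reflection B \<alpha> \<beta>)) = of_int (p \<beta> - cartan_int \<beta> \<alpha> * p \<alpha>)"
      using p_refl[OF that] of_int_cartan_int[OF that] by simp
    then show ?thesis by linarith
  qed
  define P where "P = {\<alpha> \<in> R0. p \<alpha> \<in> levels \<Delta> \<alpha>}"
  have P_refl: "root_reflection B \<alpha> \<beta> \<in> P" if "\<alpha> \<in> P" "\<beta> \<in> P" for \<alpha> \<beta>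
    using that levels_reflection[OF closed, of \<alpha> \<beta> "p \<alpha>" "p \<beta>"] p_refl'[of \<alpha> \<beta>]
      reflection_in_roots[of \<alpha> \<beta>]
    by (simp add: P_def)
  have P_simple: "a i \<in> P" if "i \<in> {1..n}" for i
    using that aR l[of "a i"] pR[of "a i"] g(2)[of "a i"] by (simp add: P_def)
  have pos: "\<beta> \<in> P" if "\<beta> \<in> R0" "\<beta> = (\<Sum>i=1..n. real (c i) *\<^sub>R a i)" for \<beta> and c :: "nat \<Rightarrow> nat"
    using that
  proof (induction "\<Sum>i=1..n. c i" arbitrary: \<beta> c rule: less_induct)
    case less
    note \<beta>R = \<open>\<beta> \<in> R0\<close>
    have "B \<beta> \<beta> = (\<Sum>i=1..n. real (c i) * B \<beta> (a i))"
    proof -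
      have "linear (B \<beta>)" using bil by (simp add: bilinear_def)
      then show ?thesis by (subst (2) less.prems(2)) (simp add: linear_sum linear_scale)
    qed
    then have "(\<Sum>i=1..n. real (c i) * B \<beta> (a i)) > 0" using B_pos[OF \<beta>R] by simp
    (* an acute angle with some simple root, as B \<beta> \<beta> > 0 *)
    then obtain i where i: "i \<in> {1..n}" "real (c i) * B \<beta> (a i) > 0"
      by (meson not_le sum_nonpos)
    then have Bi: "B \<beta> (a i) > 0" by (simp add: zero_less_mult_iff)
    define k where "k = cartan_int \<beta> (a i)"
    have "of_int k * B (a i) (a i) > 0"
      using two_B[OF aR[OF i(1)] \<beta>R] Bi by (simp add: k_def)
    then have "k > 0" using B_pos[OF aR[OF i(1)]] by (simp add: zero_less_mult_iff)
    define \<beta>' where "\<beta>' = root_reflection B (a i) \<beta>"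
    have \<beta>': "\<beta>' \<in> R0" "\<beta>' = \<beta> - of_int k *\<^sub>R a i" "\<beta> = root_reflection B (a i) \<beta>'"
      using reflection_in_roots root_reflection_eq reflection_involution aR[OF i(1)] \<beta>R
      by (simp_all add: \<beta>'_def k_def)
    obtain d :: "nat \<Rightarrow> nat" where
      "\<beta>' = (\<Sum>i=1..n. real (d i) *\<^sub>R a i) \<or> \<beta>' = - (\<Sum>i=1..n. real (d i) *\<^sub>R a i)"
      using comb[OF \<beta>'(1)] by blast
    then show ?case
    proof
      assume d: "\<beta>' = (\<Sum>i=1..n. real (d i) *\<^sub>R a i)"
      have "real (\<Sum>i=1..n. d i) = real (\<Sum>i=1..n. c i) - of_int k"
        using arg_cong[OF \<beta>'(2), of h] linear_diff[OF h(1)] linear_scale[OF h(1)] h(2) i(1)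
          hcomb[of d] hcomb[of c] d less.prems(2)
        by simp
      then have "(\<Sum>i=1..n. d i) < (\<Sum>i=1..n. c i)" using \<open>k > 0\<close> by linarith
      then have "\<beta>' \<in> P" using less.hyps \<beta>'(1) d by blast
      then show "\<beta> \<in> P" using P_refl[OF P_simple[OF i(1)]] \<beta>'(3) by simp
    next
      (* Only the coefficient of a i changes, so all others vanish and \<beta> is a i itself. *)
      assume d: "\<beta>' = - (\<Sum>i=1..n. real (d i) *\<^sub>R a i)"
      have z: "c j = 0" if j: "j \<in> {1..n}" "j \<noteq> i" for j
      proof -
        (* f is the coordinate of a j *)
        obtain f where f: "linear f" "\<And>x. x \<in> a ` {1..n} \<Longrightarrow> f x = (if x = a j then 1 else 0::real)"
          using linear_independent_extend[OF indep, of "\<lambda>x. if x = a j then 1 else 0::real"] by blast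
        have fa: "f (a t) = (if t = j then 1 else 0)" if "t \<in> {1..n}" for t
          using f(2)[of "a t"] that j(1) inj by (auto simp: inj_on_eq_iff)
        have fcomb: "f (\<Sum>i=1..n. real (u i) *\<^sub>R a i) = real (u j)" for u :: "nat \<Rightarrow> nat"
        proof -
          have "f (\<Sum>i=1..n. real (u i) *\<^sub>R a i) = (\<Sum>t=1..n. real (u t) * f (a t))"
            using f(1) by (simp add: linear_sum linear_scale)
          also have "\<dots> = (\<Sum>t=1..n. if t = j then real (u t) else 0)"
            by (rule sum.cong) (auto simp: fa)
          finally show ?thesis using j(1) by simp
        qed
        have "f \<beta>' = f \<beta>" using \<beta>'(2) linear_diff[OF f(1)] linear_scale[OF f(1)] fa[OF i(1)] j(2) by simp
        then show "c j = 0" using d less.prems(2) fcomb linear_neg[OF f(1)] by simp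
      qed
      have "\<beta> = (\<Sum>t=1..n. if t = i then real (c i) *\<^sub>R a i else 0)"
        unfolding less.prems(2) using z by (intro sum.cong) auto
      then have "\<beta> = real (c i) *\<^sub>R a i" using i(1) by simp
      moreover have "real (c i) = 1 \<or> real (c i) = - 1"
        using roots aR[OF i(1)] \<beta>R calculation unfolding finite_root_system_def by blast
      ultimately show "\<beta> \<in> P" using P_simple[OF i(1)] by auto
    qed
  qed
  have all: "p \<alpha> \<in> levels \<Delta> \<alpha>" if "\<alpha> \<in> R0" for \<alpha>
  proof -
    obtain c :: "nat \<Rightarrow> nat" where
      "\<alpha> = (\<Sum>i=1..n. real (c i) *\<^sub>R a i) \<or> \<alpha> = - (\<Sum>i=1..n. real (c i) *\<^sub>R a i)"
      using comb[OF \<open>\<alpha> \<in> R0\<close>] by blast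
    then have "\<alpha> \<in> P"
    proof
      assume "\<alpha> = - (\<Sum>i=1..n. real (c i) *\<^sub>R a i)"
      then have "- \<alpha> \<in> P" using pos minus_in_roots[OF \<open>\<alpha> \<in> R0\<close>] by (metis minus_minus)
      then show ?thesis using P_refl reflection_self minus_in_roots[OF \<open>\<alpha> \<in> R0\<close>] by (metis minus_minus)
    qed (use pos \<open>\<alpha> \<in> R0\<close> in blast)
    then show ?thesis by (simp add: P_def)
  qed
  have "Z_linear_on R0 p"
    unfolding Z_linear_on_def
  proof (intro exI[of _ p] conjI ballI)
    fix x y assume xy: "x \<in> group_closure R0" "y \<in> group_closure R0"
    have "real_of_int (p (x + y)) = of_int (p x + p y)"
      using p[OF xy(1)] p[OF xy(2)] p[OF group_closure_add[OF xy]] linear_add[OF g(1)] by simp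
    then show "p (x + y) = p x + p y" by linarith
  qed simp
  moreover have "m dvd p \<alpha>" if "\<alpha> \<in> long" for \<alpha>
    using levels_long[OF closed that all[OF long_in[OF that]]] .
  ultimately have "translate_conditions X B R0 p"
    unfolding translate_conditions_def using p_refl by blast
  then show ?thesis using that all by blast
qed

lemma maximal_with_full_gradient:
  assumes simple: "simple_roots R0 n a"
    and max: "maximal_closed_subroot_system B \<Phi> \<Psi>" and grad: "gradient R0 \<delta> \<Psi> = R0"
  shows "\<exists>p q. prime q \<and> translate_conditions X B R0 p \<and> \<Psi> = full_gradient_subsystem X B R0 \<delta> q p"
proof -
  have closed: "closed_subroot_system B \<Phi> \<Psi>" and proper: "\<Psi> \<noteq> \<Phi>"
    using max by (auto simp: maximal_closed_subroot_system_def)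
  obtain p where p: "translate_conditions X B R0 p" "\<And>\<alpha>. \<alpha> \<in> R0 \<Longrightarrow> p \<alpha> \<in> levels \<Psi> \<alpha>"
    using translate_exists[OF simple closed grad] by blast
  obtain q where q: "prime q" "\<Psi> \<subseteq> full_gradient_subsystem X B R0 \<delta> q p"
    using subset_full_if_translate_in_levels[OF p(1) closed proper p(2)] by blast
  have "\<Psi> = full_gradient_subsystem X B R0 \<delta> q p"
    using max q closed_full[OF p(1) q(1)] full_proper[OF p(1) q(1)]
    unfolding maximal_closed_subroot_system_def by blast
  then show ?thesis using p(1) q(1) by blast
qed

section \<open>Subsystems with proper gradient\<close>

abbreviation lift :: "'a set \<Rightarrow> 'a set" where "lift \<equiv> affine_lift X B R0 \<delta>"

lemma closed_subset_roots: "closed_subroot_system B R0 S \<Longrightarrow> S \<subseteq> R0"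
  by (simp add: closed_subroot_system_def subroot_system_def)

lemma lift_eq:
  assumes "S \<subseteq> R0"
  shows "lift S = {shift \<delta> r \<alpha> | \<alpha> r. \<alpha> \<in> R0 \<and> (\<alpha> \<in> short \<or> m dvd r) \<and> \<alpha> \<in> S}"
  using assms shift_in_affine_iff unfolding affine_lift_def by blast

lemma levels_lift:
  assumes "S \<subseteq> R0" "\<alpha> \<in> R0"
  shows "r \<in> levels (lift S) \<alpha> \<longleftrightarrow> \<alpha> \<in> S \<and> (\<alpha> \<in> short \<or> m dvd r)"
proof
  assume "r \<in> levels (lift S) \<alpha>"
  then obtain \<alpha>' r' where "shift \<delta> r \<alpha> = shift \<delta> r' \<alpha>'" "\<alpha>' \<in> R0" "\<alpha>' \<in> short \<or> m dvd r'" "\<alpha>' \<in> S"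
    unfolding levels_def lift_eq[OF assms(1)] by blast
  then show "\<alpha> \<in> S \<and> (\<alpha> \<in> short \<or> m dvd r)"
    using shift_inject[OF assms(2), of \<alpha>' r r'] by simp
next
  assume "\<alpha> \<in> S \<and> (\<alpha> \<in> short \<or> m dvd r)"
  then show "r \<in> levels (lift S) \<alpha>"
    unfolding levels_def lift_eq[OF assms(1)] using assms by blast
qed

lemma gradient_lift:
  assumes "S \<subseteq> R0"
  shows "gradient R0 \<delta> (lift S) = S"
proof -
  have "(\<exists>r. shift \<delta> r \<alpha> \<in> lift S) \<longleftrightarrow> \<alpha> \<in> S" if "\<alpha> \<in> R0" for \<alpha>
    using levels_lift[OF assms that] unfolding levels_def mem_Collect_eq by (metis dvd_0_right)
  then show ?thesis using assms unfolding gradient_def by blast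
qed

lemma gradient_affine: "gradient R0 \<delta> \<Phi> = R0"
  using shift_in_affine_iff[of _ 0] unfolding gradient_def by auto

lemma lift_mono: "S \<subseteq> T \<Longrightarrow> lift S \<subseteq> lift T"
  unfolding affine_lift_def by blast

lemma closed_lift:
  assumes S: "closed_subroot_system B R0 S"
  shows "closed_subroot_system B \<Phi> (lift S)"
proof (rule closed_subroot_system_levelsI[OF lift_eq[OF closed_subset_roots[OF S]]])
  obtain \<alpha> where "\<alpha> \<in> S" using S by (auto simp: closed_subroot_system_def subroot_system_def)
  then have "0 \<in> levels (lift S) \<alpha>" using levels_lift closed_subset_roots[OF S] by auto
  then show "lift S \<noteq> {}" by (auto simp: levels_def)
qed (use S in \<open>auto simp: closed_subroot_system_def subroot_system_def\<close>)

lemma lift_proper: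
  assumes "closed_subroot_system B R0 S" "S \<subset> R0"
  shows "lift S \<subset> \<Phi>"
proof -
  have "lift S \<noteq> \<Phi>" using gradient_lift[of S] gradient_affine assms(2) by auto
  then show ?thesis using subset_affine[OF closed_lift[OF assms(1)]] by blast
qed

lemma subset_lift_gradient:
  assumes "closed_subroot_system B \<Phi> \<Delta>"
  shows "\<Delta> \<subseteq> lift (gradient R0 \<delta> \<Delta>)"
proof
  fix x assume "x \<in> \<Delta>"
  moreover then obtain \<alpha> r where "\<alpha> \<in> R0" "x = shift \<delta> r \<alpha>"
    using subset_affine[OF assms] affineE by blast
  ultimately show "x \<in> lift (gradient R0 \<delta> \<Delta>)"
    using subset_affine[OF assms] unfolding affine_lift_def gradient_def by blast
qed

text \<open>The lift of the gradient is a proper closed subroot system, so it is \<open>\<Psi>\<close> by maximality.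
  Were all roots in the gradient long, the lift would lie in the system with \<open>p = 0\<close> and
  \<open>q = m\<close>, which contains all long affine roots.\<close>

lemma maximal_with_proper_gradient:
  assumes max: "maximal_closed_subroot_system B \<Phi> \<Psi>"
    and closed: "closed_subroot_system B R0 (gradient R0 \<delta> \<Psi>)"
    and proper: "gradient R0 \<delta> \<Psi> \<subset> R0"
  shows "maximal_closed_subroot_system B R0 (gradient R0 \<delta> \<Psi>)"
    and "gradient R0 \<delta> \<Psi> \<inter> short \<noteq> {}"
    and "\<Psi> = lift (gradient R0 \<delta> \<Psi>)"
proof -
  have \<Psi>: "closed_subroot_system B \<Phi> \<Psi>"
    and max': "\<And>\<Delta>. closed_subroot_system B \<Phi> \<Delta> \<Longrightarrow> \<Psi> \<subseteq> \<Delta> \<Longrightarrow> \<Delta> \<subset> \<Phi> \<Longrightarrow> \<Delta> = \<Psi>"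
    using max by (auto simp: maximal_closed_subroot_system_def)
  show eq: "\<Psi> = lift (gradient R0 \<delta> \<Psi>)"
    using max'[OF closed_lift[OF closed] subset_lift_gradient[OF \<Psi>] lift_proper[OF closed proper]] by simp
  show "maximal_closed_subroot_system B R0 (gradient R0 \<delta> \<Psi>)"
    unfolding maximal_closed_subroot_system_def
  proof (intro conjI allI impI)
    fix S assume S: "closed_subroot_system B R0 S \<and> gradient R0 \<delta> \<Psi> \<subseteq> S \<and> S \<subset> R0"
    then have "lift S = \<Psi>"
      using max' closed_lift lift_proper lift_mono[of "gradient R0 \<delta> \<Psi>" S] eq by simp
    then show "S = gradient R0 \<delta> \<Psi>" using gradient_lift[of S] S by auto
  qed (use closed proper in auto)
  show "gradient R0 \<delta> \<Psi> \<inter> short \<noteq> {}"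
  proof
    assume "gradient R0 \<delta> \<Psi> \<inter> short = {}"
    have tc: "translate_conditions X B R0 (\<lambda>_. 0)"
      unfolding translate_conditions_def Z_linear_on_def by (auto intro!: exI[of _ "\<lambda>_. 0"])
    define F where "F = full_gradient_subsystem X B R0 \<delta> (twist_order X) (\<lambda>_. 0)"
    have "\<Psi> \<subseteq> F"
    proof
      fix x assume x: "x \<in> \<Psi>"
      then obtain \<alpha> r where xr: "\<alpha> \<in> R0" "x = shift \<delta> r \<alpha>" "\<alpha> \<in> short \<or> m dvd r"
        using subset_affine[OF \<Psi>] affineE by blast
      then have "\<alpha> \<notin> short" using x \<open>_ = {}\<close> by (auto simp: gradient_def)
      then show "x \<in> F"
        unfolding F_def full_eq[OF tc prime_twist_order] using xr by auto
    qed
    then have "F = \<Psi>"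
      using max' closed_full[OF tc prime_twist_order] full_proper[OF tc prime_twist_order]
      by (simp add: F_def)
    moreover have "gradient R0 \<delta> F = R0"
      using translate_in_levels_full[OF tc prime_twist_order] unfolding F_def gradient_def levels_def by auto
    ultimately show False using proper by simp
  qed
qed

text \<open>The sum of two levels fails to be a level of \<open>x + y\<close> only if \<open>x + y\<close> is long and \<open>m\<close> does not
  divide the sum. This is impossible for two long roots, whose levels are divisible by \<open>m\<close>, and if all
  integers are levels of one of the roots.\<close>

lemma not_closed_gradient:
  assumes closed: "closed_subroot_system B \<Phi> \<Delta>"
    and x: "x \<in> gradient R0 \<delta> \<Delta>" and y: "y \<in> gradient R0 \<delta> \<Delta>"
    and xy: "x + y \<in> R0" "x + y \<notin> gradient R0 \<delta> \<Delta>"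
  shows "x \<in> short" "levels \<Delta> x \<noteq> UNIV" "x + y \<in> long"
proof -
  obtain r s where r: "x \<in> R0" "r \<in> levels \<Delta> x" and s: "y \<in> R0" "s \<in> levels \<Delta> y"
    using x y mem_gradient[OF closed] by blast
  have no: "x + y \<notin> short \<and> \<not> m dvd t + u" if "t \<in> levels \<Delta> x" "u \<in> levels \<Delta> y" for t u
    using levels_add[OF closed r(1) s(1) that] xy mem_gradient[OF closed] by blast
  show long: "x + y \<in> long" using no[OF r(2) s(2)] xy short_or_long by blast
  show "levels \<Delta> x \<noteq> UNIV" using no[of "- s" s] s by auto
  show "x \<in> short"
  proof (rule ccontr)
    assume "x \<notin> short"
    then have xl: "x \<in> long" using short_or_long r by blast
    then have "y \<in> long" using long_add_long_imp_long s long by blast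
    then have "m dvd r + s" using levels_long[OF closed] xl r s by (meson dvd_add)
    then show False using no r s by blast
  qed
qed

text \<open>The pairing of two short roots that are neither orthogonal nor proportional is \<open>\<plusminus>1\<close>, so that
  translations by \<open>\<gamma>\<close> would move \<open>x\<close> through all levels.\<close>

lemma orthogonal_if_levels_not_UNIV:
  assumes closed: "closed_subroot_system B \<Phi> \<Delta>"
    and \<gamma>: "\<gamma> \<in> short" "levels \<Delta> \<gamma> = UNIV"
    and x: "x \<in> short" "x \<in> gradient R0 \<delta> \<Delta>" "levels \<Delta> x \<noteq> UNIV"
  shows "B x \<gamma> = 0" "x \<noteq> \<gamma>" "x \<noteq> - \<gamma>"
proof -
  show ne: "x \<noteq> \<gamma>" using \<gamma> x by auto
  show ne': "x \<noteq> - \<gamma>"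
    using levels_UNIV_reflection[OF closed _ short_in[OF \<gamma>(1)] \<gamma>(2), of \<gamma>]
      mem_gradient[OF closed] \<gamma> short_in x(3) reflection_self by auto
  show "B x \<gamma> = 0"
  proof (rule ccontr)
    assume "B x \<gamma> \<noteq> 0"
    then have c: "cartan_int x \<gamma> = 1 \<or> cartan_int x \<gamma> = - 1"
      using cartan_int_equal_length short_in[OF \<gamma>(1)] short_in[OF x(1)] ne ne'
        short_length[OF x(1) short_in[OF \<gamma>(1)]] \<gamma>(1) by blast
    obtain t where t: "t \<in> levels \<Delta> x" using x(2) mem_gradient[OF closed] by blast
    have tr: "t + cartan_int x \<gamma> * (k - 0) \<in> levels \<Delta> x" for k
      using levels_translation[OF closed short_in[OF \<gamma>(1)] short_in[OF x(1)] _ _ t] \<gamma>(2) by blast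
    have "u \<in> levels \<Delta> x" for u
      using tr[of "u - t"] tr[of "t - u"] c by auto
    then show False using x(3) by auto
  qed
qed

lemma minus_short: "x \<in> short \<Longrightarrow> - x \<in> short"
  using reflection_short[of x x] reflection_self[of x] short_in by simp

text \<open>Whether \<open>x\<close> and \<open>\<gamma>\<close> are linked by being equal up to sign or having a root as their
  difference is, for fixed \<open>\<gamma>\<close>, stable under reflections: if the reflection in a
  long root moves \<open>y\<close> to \<open>y'\<close>, then \<open>y - y'\<close> is that root up to sign, and the reflection in it takes
  \<open>y - \<gamma>\<close> to \<open>y' - \<gamma>\<close>.
  By transitivity all short roots are linked. This is the situation
  of type \<open>B\<close>, where the short roots are \<open>\<plusminus>e\<^sub>i\<close>.\<close>

lemma diff_in_roots_if_short_orthogonal: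
  assumes orth: "\<And>x y. x \<in> short \<Longrightarrow> y \<in> short \<Longrightarrow> x = y \<or> x = - y \<or> B x y = 0"
    and m: "m = 2"
    and x: "x \<in> short" and \<gamma>: "\<gamma> \<in> short" and ne: "x \<noteq> \<gamma>" "x \<noteq> - \<gamma>"
  shows "x - \<gamma> \<in> R0"
proof -
  define K where "K = {y \<in> short. y = \<gamma> \<or> y = - \<gamma> \<or> y - \<gamma> \<in> R0}"
  have flip: "- y - \<gamma> \<in> R0" if "y \<in> short" "y \<noteq> \<gamma>" "y \<noteq> - \<gamma>" "y - \<gamma> \<in> R0" for y
  proof -
    have "B y \<gamma> = 0" using orth[OF that(1) \<gamma>] that by auto
    then have "cartan_int (y - \<gamma>) \<gamma> = - 2"
      using short_in[OF \<gamma>] that by (intro cartan_int_eqI) (auto simp: B_simps)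
    then have "root_reflection B \<gamma> (y - \<gamma>) = y + \<gamma>"
      using root_reflection_eq[OF short_in[OF \<gamma>] that(4)] by (simp add: scaleR_2)
    then have "y + \<gamma> \<in> R0" using reflection_in_roots[OF short_in[OF \<gamma>] that(4)] by simp
    then show ?thesis using minus_in_roots by fastforce
  qed
  have "reflection_stable K"
    unfolding reflection_stable_def
  proof (intro conjI ballI)
    show "K \<noteq> {}" "K \<subseteq> R0" using \<gamma> short_in by (auto simp: K_def)
    fix y z assume y: "y \<in> K" and z: "z \<in> R0"
    have ys: "y \<in> short" and yR: "y \<in> R0" using y short_in by (auto simp: K_def)
    have negK: "- y \<in> K"
    proof (cases "y = \<gamma> \<or> y = - \<gamma>")
      case True
      then show ?thesis using minus_short[OF ys] by (auto simp: K_def)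
    next
      case False
      then show ?thesis using y flip[OF ys] minus_short[OF ys] by (simp add: K_def)
    qed
    define y' where "y' = root_reflection B z y"
    have y': "y' \<in> short" "y' = y - of_int (cartan_int y z) *\<^sub>R z"
      using reflection_short[OF z ys] root_reflection_eq[OF z yR] by (auto simp: y'_def)
    consider (perp) "B y z = 0" | (self) "z \<in> short" "y = z \<or> y = - z" | (long) "z \<in> long" "B y z \<noteq> 0"
      using short_or_long[OF z] orth[OF ys] by blast
    then have "y' \<in> K"
    proof cases
      case perp
      then show ?thesis using y y'(2) cartan_int_eq_0_iff[OF z yR] by simp
    next
      case self
      then have "y' = - y"
        using reflection_self[OF z] reflection_self[OF yR] unfolding y'_def
        by (auto simp: root_reflection_def cartan_pairing_def B_simps)
      then show ?thesis using negK by simp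
    next
      case long
      then have "cartan_int y z = 1 \<or> cartan_int y z = - 1"
        using cartan_int_long_short(2)[OF long(1) ys] sym[of y z] by simp
      then have diff: "y - y' \<in> R0" using y'(2) z minus_in_roots[OF z] by auto
      show ?thesis
      proof (cases "y' = \<gamma> \<or> y' = - \<gamma> \<or> y' = y \<or> y' = - y")
        case True
        then show ?thesis using y y'(1) negK by (auto simp: K_def)
      next
        case False
        then have o: "B y' \<gamma> = 0" "B y' y = 0" using orth y'(1) \<gamma> ys by blast+
        have "y' - \<gamma> \<in> R0"
        proof (cases "y = \<gamma> \<or> y = - \<gamma>")
          case True
          then show ?thesis
          proof
            assume "y = \<gamma>"
            then show ?thesis using minus_in_roots[OF diff] by simp
          next
            assume "y = - \<gamma>"
            then have "- y' - \<gamma> = y - y'" by simp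
            then have "- y' - \<gamma> \<in> R0" using diff by (simp only:)
            then show ?thesis
              using flip[OF minus_short[OF y'(1)]] False by (auto simp: minus_equation_iff[of y'])
          qed
        next
          (* The differences y - y' and y - \<gamma> have pairing 1, so that the reflection in the first
             subtracts it from the second. *)
          case ny: False
          then have yg: "y - \<gamma> \<in> R0" "B y \<gamma> = 0" using y orth[OF ys \<gamma>] by (auto simp: K_def)
          have len: "B y y = B \<gamma> \<gamma>" "B y' y' = B \<gamma> \<gamma>"
            using short_length[OF \<gamma> yR] short_length[OF \<gamma> short_in[OF y'(1)]] ys y'(1) by simp_all
          have "cartan_int (y - \<gamma>) (y - y') = 1"
            using yg o len sym[of y y'] sym[of \<gamma> y'] diff
            by (intro cartan_int_eqI) (auto simp: B_simps sym[of \<gamma> y])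
          then have "root_reflection B (y - y') (y - \<gamma>) = y' - \<gamma>"
            using root_reflection_eq[OF diff yg(1)] by simp
          then show ?thesis using reflection_in_roots[OF diff yg(1)] by simp
        qed
        then show ?thesis using y'(1) by (simp add: K_def)
      qed
    qed
    then show "root_reflection B z y \<in> K" by (simp add: y'_def)
  qed
  moreover have "\<gamma> \<in> K" using \<gamma> by (simp add: K_def)
  ultimately have "x \<in> K"
    using reflection_stable_equal_length short_length[OF \<gamma> short_in[OF x]] x short_in by blast
  then show ?thesis using ne by (simp add: K_def)
qed

text \<open>Pairing with \<open>x\<close> is additive, so divisibility passes to sums and reflections.\<close>

lemma closed_divisible_pairing:
  assumes x: "x \<in> R0" and ne: "{z \<in> R0. m dvd cartan_int z x} \<noteq> {}"
  shows "closed_subroot_system B R0 {z \<in> R0. m dvd cartan_int z x}"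
  unfolding closed_subroot_system_def subroot_system_def
  using ne x by (auto simp: reflection_in_roots cartan_int_reflection cartan_int_add)

text \<open>Let \<open>x\<close> and \<open>y\<close> be roots of the gradient of \<open>\<Delta>\<close> whose sum is a root outside it. Then
  \<open>x\<close> is short, and every root of \<open>S\<close> has a pairing with \<open>x\<close> divisible by \<open>m\<close>: the short
  ones are orthogonal to \<open>x\<close>. If the closed system of all such roots is proper, it is \<open>S\<close>, which
  then contains all long roots and in particular \<open>x + y\<close>. Otherwise any two short roots are
  orthogonal or proportional, so a short \<open>\<gamma>\<close> in \<open>S\<close> satisfies \<open>x - \<gamma> \<in> R0\<close>; this long root
  belongs to the gradient and its reflection carries \<open>\<gamma>\<close>, with all its levels, to \<open>x\<close>.\<close>

lemma gradient_closed_if_lift_subset: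
  assumes max: "maximal_closed_subroot_system B R0 S" and S_short: "S \<inter> short \<noteq> {}"
    and closed: "closed_subroot_system B \<Phi> \<Delta>" and sub: "lift S \<subseteq> \<Delta>"
    and x: "x \<in> gradient R0 \<delta> \<Delta>" and y: "y \<in> gradient R0 \<delta> \<Delta>" and xy: "x + y \<in> R0"
  shows "x + y \<in> gradient R0 \<delta> \<Delta>"
proof (rule ccontr)
  assume notin: "x + y \<notin> gradient R0 \<delta> \<Delta>"
  have S: "closed_subroot_system B R0 S" "S \<subseteq> R0" and S_max:
    "\<And>T. closed_subroot_system B R0 T \<Longrightarrow> S \<subseteq> T \<Longrightarrow> T \<subset> R0 \<Longrightarrow> T = S"
    using max by (auto simp: maximal_closed_subroot_system_def)
  note bad = not_closed_gradient[OF closed x y xy notin]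
  have levS: "r \<in> levels \<Delta> \<alpha>" if "\<alpha> \<in> S" "\<alpha> \<in> short \<or> m dvd r" for \<alpha> r
    using levels_lift[OF S(2), of \<alpha> r] that S(2) sub unfolding levels_def by blast
  have S_grad: "S \<subseteq> gradient R0 \<delta> \<Delta>" using levS[of _ 0] S(2) mem_gradient[OF closed] by auto
  have xR: "x \<in> R0" using short_in bad(1) .
  have perp: "B x \<gamma> = 0" "x \<noteq> \<gamma>" "x \<noteq> - \<gamma>" if "\<gamma> \<in> S" "\<gamma> \<in> short" for \<gamma>
    using orthogonal_if_levels_not_UNIV[OF closed that(2) _ bad(1) x bad(2)] levS[OF that(1)] that(2)
    by blast+
  define T where "T = {z \<in> R0. m dvd cartan_int z x}"
  have longT: "long \<subseteq> T"
    using dvd_cartan_int_long_short[OF _ bad(1)] long_in by (auto simp: T_def)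
  have ST: "S \<subseteq> T"
  proof
    fix z assume z: "z \<in> S"
    show "z \<in> T"
    proof (cases "z \<in> short")
      case True
      then have "cartan_int z x = 0" using perp[OF z True] cartan_int_eq_0_iff[OF xR, of z] z S(2) sym[of x z] by auto
      then show ?thesis using z S(2) by (auto simp: T_def)
    next
      case False
      then show ?thesis using z S(2) longT short_or_long by blast
    qed
  qed
  have T: "closed_subroot_system B R0 T" "T \<subseteq> R0"
    using closed_divisible_pairing[OF xR] longT long_nonempty by (auto simp: T_def)
  show False
  proof (cases "T = R0")
    case False
    then have "x + y \<in> S" using S_max[OF T(1) ST] T(2) longT bad(3) by blast
    then show False using S_grad notin by blast
  next
    case True
    obtain \<gamma> where \<gamma>: "\<gamma> \<in> S" "\<gamma> \<in> short" using S_short by blast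
    have m2: "m = 2"
    proof -
      have "x \<in> T" using True xR by blast
      then have "m dvd 2" using cartan_int_self[OF xR] by (simp add: T_def)
      then show ?thesis using twist_order_cases by auto
    qed
    (* The Weyl group carries the divisibility of all pairings with x to all short roots. *)
    have "reflection_stable {u \<in> R0. \<forall>z\<in>R0. m dvd cartan_int z u}"
      unfolding reflection_stable_def
    proof (intro conjI ballI)
      show "{u \<in> R0. \<forall>z\<in>R0. m dvd cartan_int z u} \<noteq> {}" using True xR by (auto simp: T_def)
      fix u v assume u: "u \<in> {u \<in> R0. \<forall>z\<in>R0. m dvd cartan_int z u}" and v: "v \<in> R0"
      have "cartan_int z (root_reflection B v u) = cartan_int (root_reflection B v z) u"
        if z: "z \<in> R0" for z
      proof (rule cartan_int_eqI)
        show "root_reflection B v u \<in> R0" "z \<in> R0" using u v z reflection_in_roots by auto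
        have "B z (root_reflection B v u) = B (root_reflection B v z) u"
          using sym[of u v] sym[of v z] by (simp add: root_reflection_def cartan_pairing_def B_simps)
        then show "2 * B z (root_reflection B v u) = of_int (cartan_int (root_reflection B v z) u) *
            B (root_reflection B v u) (root_reflection B v u)"
          using two_B[of u "root_reflection B v z"] u v z B_reflection[of v u] reflection_in_roots by simp
      qed
      then show "root_reflection B v u \<in> {u \<in> R0. \<forall>z\<in>R0. m dvd cartan_int z u}"
        using u v reflection_in_roots by auto
    qed auto
    moreover have "x \<in> {u \<in> R0. \<forall>z\<in>R0. m dvd cartan_int z u}" using True xR by (auto simp: T_def)
    ultimately have even: "m dvd cartan_int z u" if "u \<in> short" "z \<in> R0" for u z
      using reflection_stable_equal_length[of _ x u] short_length[OF bad(1)] that short_in by blast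
    have "u = v \<or> u = - v \<or> B u v = 0" if uv: "u \<in> short" "v \<in> short" for u v
    proof (rule ccontr)
      assume "\<not> (u = v \<or> u = - v \<or> B u v = 0)"
      then have "cartan_int u v = 1 \<or> cartan_int u v = - 1"
        using cartan_int_equal_length uv short_in short_length by blast
      then show False using even[OF uv(2) short_in[OF uv(1)]] m2 by auto
    qed
    then have d: "x - \<gamma> \<in> R0"
      using diff_in_roots_if_short_orthogonal[OF _ m2 bad(1) \<gamma>(2)] perp[OF \<gamma>] by blast
    note \<gamma>R = short_in[OF \<gamma>(2)] and o = perp(1)[OF \<gamma>]
    have len: "B x x = B \<gamma> \<gamma>" using short_length[OF bad(1) \<gamma>R] \<gamma>(2) by simp
    obtain r where r: "r \<in> levels \<Delta> x" using x mem_gradient[OF closed] by blast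
    have "r + - r \<in> levels \<Delta> (x + - \<gamma>)"
      using levels_add[OF closed xR minus_in_roots[OF \<gamma>R] r levels_uminus[OF closed \<gamma>R levS[of \<gamma> r]]]
        d \<gamma> by auto
    then have "x - \<gamma> \<in> gradient R0 \<delta> \<Delta>" using d mem_gradient[OF closed] by auto
    moreover have "cartan_int \<gamma> (x - \<gamma>) = - 1"
      using d \<gamma>R o len sym[of x \<gamma>] by (intro cartan_int_eqI) (auto simp: B_simps)
    then have "root_reflection B (x - \<gamma>) \<gamma> = x" using root_reflection_eq[OF d \<gamma>R] by simp
    moreover have "levels \<Delta> \<gamma> = UNIV" using levS \<gamma> by blast
    ultimately show False
      using levels_UNIV_reflection[OF closed _ \<gamma>R] bad(2) by metis
  qed
qed

text \<open>The gradient of a system above the lift is closed, hence \<open>S\<close> or \<open>R0\<close>. In the second case a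
  short root of \<open>S\<close>, which has all levels, forces the system to be \<open>\<Phi>\<close>.\<close>

lemma maximal_lift:
  assumes max: "maximal_closed_subroot_system B R0 S" and S_short: "S \<inter> short \<noteq> {}"
  shows "maximal_closed_subroot_system B \<Phi> (lift S)"
  unfolding maximal_closed_subroot_system_def
proof (intro conjI allI impI)
  have S: "closed_subroot_system B R0 S" "S \<subset> R0" and S_max:
    "\<And>T. closed_subroot_system B R0 T \<Longrightarrow> S \<subseteq> T \<Longrightarrow> T \<subset> R0 \<Longrightarrow> T = S"
    using max by (auto simp: maximal_closed_subroot_system_def)
  show "closed_subroot_system B \<Phi> (lift S)" "lift S \<subset> \<Phi>"
    using closed_lift lift_proper S by auto
  fix \<Delta> assume "closed_subroot_system B \<Phi> \<Delta> \<and> lift S \<subseteq> \<Delta> \<and> \<Delta> \<subset> \<Phi>"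
  then have \<Delta>: "closed_subroot_system B \<Phi> \<Delta>" "lift S \<subseteq> \<Delta>" "\<Delta> \<subset> \<Phi>" by auto
  have levS: "r \<in> levels \<Delta> \<alpha>" if "\<alpha> \<in> S" "\<alpha> \<in> short \<or> m dvd r" for \<alpha> r
    using levels_lift[of S \<alpha> r] that S(2) \<Delta>(2) unfolding levels_def by blast
  have sub: "S \<subseteq> gradient R0 \<delta> \<Delta>" using levS[of _ 0] S(2) mem_gradient[OF \<Delta>(1)] by auto
  have "gradient R0 \<delta> \<Delta> \<subseteq> R0" by (auto simp: gradient_def)
  moreover have "closed_subroot_system B R0 (gradient R0 \<delta> \<Delta>)"
    using gradient_closed_if_lift_subset[OF max S_short \<Delta>(1,2)] gradient_reflection[OF \<Delta>(1)]
      sub S \<open>gradient R0 \<delta> \<Delta> \<subseteq> R0\<close>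
    unfolding closed_subroot_system_def subroot_system_def by blast
  moreover have "gradient R0 \<delta> \<Delta> \<noteq> R0"
  proof
    assume grad: "gradient R0 \<delta> \<Delta> = R0"
    obtain \<gamma> where "\<gamma> \<in> S" "\<gamma> \<in> short" using S_short by blast
    then show False
      using eq_affine_if_short_levels_UNIV[OF \<Delta>(1) grad, of \<gamma>] levS \<Delta>(3) by blast
  qed
  ultimately have "gradient R0 \<delta> \<Delta> = S" using S_max sub by blast
  then show "\<Delta> = lift S" using subset_lift_gradient[OF \<Delta>(1)] \<Delta>(2) by auto
qed

end

section \<open>The twisted affine types\<close>

lemma admissible_Cartan_facts:
  assumes "admissible_type X"
  defines "n \<equiv> type_rank (underlying_type X)" and "M \<equiv> cartan_matrix (underlying_type X)"
  shows "n \<ge> 2"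
    and "i \<in> {1..<n} \<Longrightarrow> M i (Suc i) \<noteq> 0"
    and "\<exists>i\<in>{1..n}. \<exists>j\<in>{1..n}. M i j = - int (twist_order X) \<and> M j i = - 1"
proof -
  show "n \<ge> 2" using assms(1) by (cases X) (auto simp: n_def)
  show "M i (Suc i) \<noteq> 0" if "i \<in> {1..<n}"
    using assms(1) that by (cases X) (auto simp: n_def M_def linear_cartan_def)
  show "\<exists>i\<in>{1..n}. \<exists>j\<in>{1..n}. M i j = - int (twist_order X) \<and> M j i = - 1"
  proof (cases X)
    case (TwistedA_odd k)
    then show ?thesis using assms(1) unfolding n_def M_def
      by (intro bexI[of _ k] bexI[of _ "k - 1"]) (auto simp: linear_cartan_def)
  next
    case (TwistedD k)
    then show ?thesis using assms(1) unfolding n_def M_def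
      by (intro bexI[of _ "k - 1"] bexI[of _ k]) (auto simp: linear_cartan_def)
  next
    case TwistedE6
    then show ?thesis unfolding n_def M_def
      by (intro bexI[of _ 2] bexI[of _ 3]) (auto simp: linear_cartan_def)
  next
    case TwistedD4
    then show ?thesis unfolding n_def M_def
      by (intro bexI[of _ 2] bexI[of _ 1]) (auto simp: linear_cartan_def)
  qed
qed

text \<open>Consecutive simple roots are not orthogonal, so an orthogonal decomposition of the roots
  has all simple roots in one part, and the other part is orthogonal to its own span.\<close>

lemma twisted_affine_datum_imp_roots:
  assumes datum: "twisted_affine_datum X B R0 \<delta>"
  shows "twisted_affine_roots B R0 X \<delta>" and "\<exists>n a. simple_roots R0 n a"
proof -
  have adm: "admissible_type X" and bil: "bilinear B" and sym: "\<And>x y. B x y = B y x"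
    and type: "root_system_of_type (underlying_type X) B R0"
    and \<delta>: "\<delta> \<notin> span R0" "\<And>x. B \<delta> x = 0"
    using datum unfolding twisted_affine_datum_def by blast+
  define n where "n = type_rank (underlying_type X)"
  define M where "M = cartan_matrix (underlying_type X)"
  note facts = admissible_Cartan_facts[OF adm, folded n_def M_def]
  obtain a where simple: "simple_roots R0 n a"
    and Cartan: "\<And>i j. i \<in> {1..n} \<Longrightarrow> j \<in> {1..n} \<Longrightarrow> cartan_pairing B (a i) (a j) = of_int (M i j)"
    using type unfolding root_system_of_type_def n_def M_def by blast
  then show "\<exists>n a. simple_roots R0 n a" by blast
  interpret crystallographic_roots B R0
    by unfold_locales (use bil sym type in \<open>auto simp: root_system_of_type_def\<close>)
  have aR: "a i \<in> R0" if "i \<in> {1..n}" for i using simple that by (auto simp: simple_roots_def)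
  have comb: "\<exists>c::nat \<Rightarrow> nat. \<beta> = (\<Sum>i=1..n. real (c i) *\<^sub>R a i) \<or> \<beta> = - (\<Sum>i=1..n. real (c i) *\<^sub>R a i)"
    if "\<beta> \<in> R0" for \<beta> using simple that unfolding simple_roots_def by blast
  have adjacent: "B (a i) (a (Suc i)) \<noteq> 0" if "i \<in> {1..<n}" for i
    using facts(2)[OF that] Cartan[of i "Suc i"] that by (auto simp: cartan_pairing_def)
  have not_perp: "\<exists>i\<in>{1..n}. B \<beta> (a i) \<noteq> 0" if \<beta>: "\<beta> \<in> R0" for \<beta>
  proof (rule ccontr)
    assume "\<not> ?thesis"
    moreover have "linear (B \<beta>)" using bil by (simp add: bilinear_def)
    ultimately have zero: "B \<beta> (\<Sum>i=1..n. real (c i) *\<^sub>R a i) = 0" for c :: "nat \<Rightarrow> nat"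
      by (simp add: linear_sum linear_scale)
    obtain c :: "nat \<Rightarrow> nat" where
      "\<beta> = (\<Sum>i=1..n. real (c i) *\<^sub>R a i) \<or> \<beta> = - (\<Sum>i=1..n. real (c i) *\<^sub>R a i)"
      using comb[OF \<beta>] by blast
    then have "B \<beta> \<beta> = 0"
    proof
      assume "\<beta> = (\<Sum>i=1..n. real (c i) *\<^sub>R a i)"
      then show ?thesis using zero[of c] by simp
    next
      assume "\<beta> = - (\<Sum>i=1..n. real (c i) *\<^sub>R a i)"
      then have "(\<Sum>i=1..n. real (c i) *\<^sub>R a i) = - \<beta>" by simp
      then show ?thesis using zero[of c] by (simp add: B_simps)
    qed
    then show False using B_pos[OF \<beta>] by simp
  qed
  have irred: "T = R0"
    if T: "T \<subseteq> R0" "T \<noteq> {}" and perp: "\<And>x y. x \<in> T \<Longrightarrow> y \<in> R0 - T \<Longrightarrow> B x y = 0" for T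
  proof -
    have same: "a i \<in> T \<longleftrightarrow> a 1 \<in> T" if "i \<in> {1..n}" for i
    proof -
      have "1 \<le> i" "i \<le> n" using that by auto
      then show ?thesis
      proof (induction i rule: dec_induct)
        case (step j)
        have "B (a j) (a (Suc j)) \<noteq> 0" using adjacent[of j] step by simp
        then have "a j \<in> T \<longleftrightarrow> a (Suc j) \<in> T"
          using perp[of "a j" "a (Suc j)"] perp[of "a (Suc j)" "a j"] aR[of j] aR[of "Suc j"] step
            sym[of "a j"] by auto
        then show ?case using step by simp
      qed simp
    qed
    show "T = R0"
    proof (cases "a 1 \<in> T")
      case True
      show ?thesis
      proof (rule ccontr)
        assume "T \<noteq> R0"
        then obtain y where y: "y \<in> R0 - T" using T by blast
        then obtain i where i: "i \<in> {1..n}" "B y (a i) \<noteq> 0" using not_perp by blast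
        have "B (a i) y = 0" using perp[OF _ y] same[OF i(1)] True by blast
        then show False using i(2) sym[of y "a i"] by simp
      qed
    next
      case False
      obtain x where x: "x \<in> T" using T by blast
      then obtain i where i: "i \<in> {1..n}" "B x (a i) \<noteq> 0" using not_perp T by blast
      have "a i \<in> R0 - T" using same[OF i(1)] False aR[OF i(1)] by blast
      then show ?thesis using perp[OF x] i(2) by blast
    qed
  qed
  have "\<exists>x\<in>R0. \<exists>y\<in>R0. B y y = real (twist_order X) * B x x"
  proof -
    obtain i j where ij: "i \<in> {1..n}" "j \<in> {1..n}" "M i j = - int (twist_order X)" "M j i = - 1"
      using facts(3) by blast
    have "2 * B (a i) (a j) = - real (twist_order X) * B (a j) (a j)" "2 * B (a j) (a i) = - B (a i) (a i)"
      using Cartan[OF ij(1,2)] Cartan[OF ij(2,1)] ij(3,4) B_pos[OF aR[OF ij(1)]] B_pos[OF aR[OF ij(2)]]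
      by (simp_all add: cartan_pairing_def field_simps)
    then have "B (a i) (a i) = real (twist_order X) * B (a j) (a j)" using sym[of "a i" "a j"] by simp
    then show ?thesis using aR ij(1,2) by blast
  qed
  then show "twisted_affine_roots B R0 X \<delta>"
    by unfold_locales (use irred \<delta> in auto)
qed

theorem theorem5p2p2:
  fixes X :: twisted_type
    and B :: "'v::real_vector \<Rightarrow> 'v \<Rightarrow> real"
    and R0 :: "'v set"
    and \<delta> :: 'v
  assumes "twisted_affine_datum X B R0 \<delta>"
  shows
    "(\<forall>\<Psi>. maximal_closed_subroot_system B (affine_roots X B R0 \<delta>) \<Psi> \<and> gradient R0 \<delta> \<Psi> = R0 \<longrightarrow>
        (\<exists>(p :: 'v \<Rightarrow> int) (q :: nat). prime q \<and> translate_conditions X B R0 p \<and>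
           \<Psi> = full_gradient_subsystem X B R0 \<delta> q p))
   \<and> (\<forall>(p :: 'v \<Rightarrow> int) (q :: nat). prime q \<and> translate_conditions X B R0 p \<longrightarrow>
        maximal_closed_subroot_system B (affine_roots X B R0 \<delta>)
          (full_gradient_subsystem X B R0 \<delta> q p))
   \<and> (\<forall>\<Psi>. maximal_closed_subroot_system B (affine_roots X B R0 \<delta>) \<Psi> \<and>
           closed_subroot_system B R0 (gradient R0 \<delta> \<Psi>) \<and> gradient R0 \<delta> \<Psi> \<subset> R0 \<longrightarrow>
        maximal_closed_subroot_system B R0 (gradient R0 \<delta> \<Psi>) \<and>
        gradient R0 \<delta> \<Psi> \<inter> short_roots B R0 \<noteq> {} \<and>
        \<Psi> = affine_lift X B R0 \<delta> (gradient R0 \<delta> \<Psi>))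
   \<and> (\<forall>S. maximal_closed_subroot_system B R0 S \<and> S \<inter> short_roots B R0 \<noteq> {} \<longrightarrow>
        maximal_closed_subroot_system B (affine_roots X B R0 \<delta>) (affine_lift X B R0 \<delta> S))"
proof -
  interpret twisted_affine_roots B R0 X \<delta>
    by (rule twisted_affine_datum_imp_roots(1)[OF assms])
  obtain n a where simple: "simple_roots R0 n a"
    using twisted_affine_datum_imp_roots(2)[OF assms] by blast
  show ?thesis
  proof (intro conjI allI impI; elim conjE)
    fix \<Psi> assume "maximal_closed_subroot_system B \<Phi> \<Psi>" "gradient R0 \<delta> \<Psi> = R0"
    then show "\<exists>p q. prime q \<and> translate_conditions X B R0 p \<and> \<Psi> = full_gradient_subsystem X B R0 \<delta> q p"
      by (rule maximal_with_full_gradient[OF simple])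
  next
    fix p :: "'v \<Rightarrow> int" and q :: nat
    assume "prime q" "translate_conditions X B R0 p"
    then show "maximal_closed_subroot_system B \<Phi> (full_gradient_subsystem X B R0 \<delta> q p)"
      using maximal_full by blast
  next
    fix \<Psi> assume *: "maximal_closed_subroot_system B \<Phi> \<Psi>"
      "closed_subroot_system B R0 (gradient R0 \<delta> \<Psi>)" "gradient R0 \<delta> \<Psi> \<subset> R0"
    show "maximal_closed_subroot_system B R0 (gradient R0 \<delta> \<Psi>)"
      "gradient R0 \<delta> \<Psi> \<inter> short \<noteq> {}" "\<Psi> = lift (gradient R0 \<delta> \<Psi>)"
      using maximal_with_proper_gradient[OF *] .
  next
    fix S assume "maximal_closed_subroot_system B R0 S" "S \<inter> short \<noteq> {}"
    then show "maximal_closed_subroot_system B \<Phi> (lift S)" by (rule maximal_lift)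
  qed
qed

end
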